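(* Suppose $f\in\mathcal{O}^\ast$, $\alpha>1$, $f^\alpha=\sum_{i=1}^kc_iK_{w_i,\alpha}$ on $\mathbb{D}$, and $(\mathbf c,\mathbf w)\in\Lambda_\alpha\cup\Gamma$, where $\mathbf c=(c_1,\dots,c_k)$ and $\mathbf w=(w_1,\dots,w_k)$. Suppose one of the following holds. (1) $c_i\ge0$ for $i=1,\dots,k$. (2) $w_1<\cdots<w_k$, and either $c_2,\dots,c_k$ are all real and have the same sign, or $c_1,\dots,c_{k-1}$ are all real and have the same sign (same sign meaning all $\ge0$ or all $\le0$). (3) $k=2$. Then $\frac{\partial}{\partial\alpha}N_f(\alpha)\le0$ (at this value of $\alpha$).
   Context: $\mathbb{D}$ is the open unit disc in $\mathbb{C}$ and $\mathbb{H}=\{z\in\mathbb{C}:\mathrm{Re}\,z>0\}$. $\mathcal{O}^\ast$ is the set of functions $f$ holomorphic in some open neighborhood of $\overline{\mathbb{D}}$ with $f(z)\ne0$ for all $z\in\overline{\mathbb{D}}$. For $\alpha>1$, \[ N_f(\alpha)=\Big(\int_{\mathbb{D}}|f(z)|^{2\alpha}(\alpha-1)(1-|z|^2)^{\alpha-2}\,\frac{dx\,dy}{\pi}\Big)^{\frac{1}{2\alpha}}, \] and $\frac{\partial}{\partial\alpha}N_f(\alpha)$ is its derivative in $\alpha$ with $f$ fixed. $K_{w,\alpha}(z)=\frac{1}{(1-\overline{w}z)^\alpha}$ (principal branch). $f^\alpha$ denotes $e^{\alpha h}$, where $h$ is a holomorphic function on $\mathbb{D}$ with $f=e^h$. $\Lambda_\alpha$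 is the set of pairs $(\mathbf c,\mathbf w)$ with $\mathbf c\in\mathbb{C}^k$, $\mathbf w\in(-1,1)^k$, $k$ a positive integer, such that for every $i=1,\dots,k$ the number $f_{i,\alpha}=\sum_{j=1}^kc_j\frac{1}{(1-\overline{w_j}w_i)^\alpha}$ belongs to $\mathbb{H}$. $\Gamma$ is the set of pairs $(\mathbf c,\mathbf w)$ with $\mathbf c\in\mathbb{R}^k$, $\mathbf w\in(-1,1)^k$, $k$ a positive integer. *)

theory Defs
  imports "HOL-Complex_Analysis.Complex_Analysis"
begin

definition right_half_plane :: "complex set" where
  "right_half_plane = {z. Re z > 0}"

definition O_star :: "(complex \<Rightarrow> complex) set" where
  "O_star = {f. (\<exists>U. open U \<and> cball 0 1 \<subseteq> U \<and> f holomorphic_on U) \<and> (\<forall>z\<in>cball 0 1. f z \<noteq> 0)}"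

definition N :: "(complex \<Rightarrow> complex) \<Rightarrow> real \<Rightarrow> real" where
  "N f \<alpha> = (LINT z:ball 0 1|lborel.
      norm (f z) powr (2 * \<alpha>) * (\<alpha> - 1) * (1 - (norm z)\<^sup>2) powr (\<alpha> - 2) / pi) powr (1 / (2 * \<alpha>))"

text \<open>For complex arguments, \<open>powr\<close> is defined through \<open>Ln\<close>, i.e. it is the principal branch.\<close>

definition K :: "complex \<Rightarrow> real \<Rightarrow> complex \<Rightarrow> complex" where
  "K w \<alpha> z = 1 / (1 - cnj w * z) powr complex_of_real \<alpha>"

text \<open>
  Vectors of variable length \<open>k\<close> are lists, so indices run over \<open>0..<k\<close> instead of \<open>1..k\<close>.
\<close>

definition Lambda_set :: "real \<Rightarrow> (complex list \<times> real list) set" where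
  "Lambda_set \<alpha> = {(c, w). length c = length w \<and> length w > 0 \<and> set w \<subseteq> {-1<..<1} \<and>
     (\<forall>i<length w. (\<Sum>j<length w. c ! j * K (of_real (w ! j)) \<alpha> (of_real (w ! i)))
        \<in> right_half_plane)}"

text \<open>Real coefficients are kept as complex numbers lying in \<open>\<real>\<close>, so that
  \<open>Gamma_set\<close> and \<open>Lambda_set \<alpha>\<close> have the same type.\<close>

definition Gamma_set :: "(complex list \<times> real list) set" where
  "Gamma_set = {(c, w). length c = length w \<and> length w > 0 \<and> set w \<subseteq> {-1<..<1} \<and> set c \<subseteq> \<real>}"

end

theory Submission
  imports Defs
begin

text \<open>
  Let \<open>\<mu>\<^sub>\<beta>\<close> be the measure on the unit disc with density \<open>(\<beta> - 1) (1 - |z|\<^sup>2) powr (\<beta> - 2) / \<pi>\<close>,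
  and put \<open>I(\<beta>) = \<integral> exp (2 \<beta> Re h) d\<mu>\<^sub>\<beta>\<close> with \<open>f = exp h\<close>.  Then
  \<open>N f \<beta> = I(\<beta>) powr (1 / (2 \<beta>))\<close>, so the derivative of \<open>N f\<close> at \<open>\<alpha>\<close> has the sign of
  \<open>\<alpha> I'(\<alpha>) - I(\<alpha>) ln I(\<alpha>)\<close>.

  The derivative \<open>I'(\<alpha>)\<close> comes from a variational argument.  By the reproducing property of the
  kernels, for every \<open>\<beta> > 1\<close> the square norm of \<open>exp (\<beta> h) - \<Sum>\<^sub>i c\<^sub>i K(w\<^sub>i, \<beta>)\<close> equals
  \<open>I(\<beta>) - R(\<beta>)\<close>, where \<open>R\<close> is a finite sum of exponentials in \<open>\<beta>\<close>.  This difference is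
  nonnegative and vanishes at \<open>\<beta> = \<alpha>\<close>, hence \<open>I'(\<alpha>) = R'(\<alpha>)\<close> (lemma \<open>bergman_norm_derivative\<close>).
  With \<open>k\<^sub>i\<^sub>j = (1 - w\<^sub>i w\<^sub>j) powr (- \<alpha>)\<close>, \<open>u\<^sub>i = \<Sum>\<^sub>j c\<^sub>j k\<^sub>i\<^sub>j\<close> and \<open>E = I(\<alpha>) = \<Sum>\<^sub>i cnj c\<^sub>i u\<^sub>i\<close>, the claim
  becomes the finite inequality

  \<open>2 Re (\<Sum>\<^sub>i cnj c\<^sub>i u\<^sub>i log u\<^sub>i) \<le> \<Sum>\<^sub>i \<Sum>\<^sub>j Re (cnj c\<^sub>i c\<^sub>j) k\<^sub>i\<^sub>j ln k\<^sub>i\<^sub>j + E ln E\<close>.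

  For nonnegative coefficients this says that the mutual information of the joint distribution
  \<open>c\<^sub>i c\<^sub>j k\<^sub>i\<^sub>j / E\<close> is nonnegative; what is needed is a version for other signs and phases.

  Under each of the three alternatives there is a node \<open>w\<^sub>s\<close> such that all nodes lie on one side
  of \<open>w\<^sub>s\<close> and all coefficients other than \<open>c\<^sub>s\<close> have a common phase.  A disc automorphism taking
  \<open>w\<^sub>s\<close> to \<open>0\<close>, together with a rescaling of the coefficients, turns the kernel into
  \<open>(1 - x\<^sub>i x\<^sub>j) powr (- \<alpha>)\<close> with \<open>x\<^sub>i x\<^sub>j \<ge> 0\<close> and \<open>x\<^sub>s = 0\<close>.  Now let the exponent run from \<open>0\<close> to \<open>\<alpha>\<close>
  with the new coefficients fixed.  At exponent \<open>0\<close> the two sides agree.  In the derivative of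
  their difference every term involving \<open>s\<close> drops out, because the row \<open>k\<^sub>s\<^sub>j = 1\<close> is constant; there
  remains, with \<open>r\<^sub>i = |c\<^sub>i|\<close> and \<open>\<kappa>\<^sub>i\<^sub>j = - ln (1 - x\<^sub>i x\<^sub>j) \<ge> 0\<close>,

  \<open>\<Sum>\<^sub>i \<Sum>\<^sub>j r\<^sub>i r\<^sub>j \<kappa>\<^sub>i\<^sub>j k\<^sub>i\<^sub>j ln (k\<^sub>i\<^sub>j E / (|u\<^sub>i| |u\<^sub>j|))\<close>.

  By \<open>ln y \<ge> 1 - 1 / y\<close> this is nonnegative as soon as
  \<open>\<Sum>\<^sub>i \<Sum>\<^sub>j r\<^sub>i r\<^sub>j \<kappa>\<^sub>i\<^sub>j |u\<^sub>i| |u\<^sub>j| \<le> E \<Sum>\<^sub>i \<Sum>\<^sub>j r\<^sub>i r\<^sub>j \<kappa>\<^sub>i\<^sub>j k\<^sub>i\<^sub>j\<close>.  Here \<open>|u\<^sub>i|\<close> may be replaced by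
  its upper bound \<open>|u\<^sub>s| + \<Sum>\<^sub>j r\<^sub>j (k\<^sub>i\<^sub>j - 1)\<close>, the sum being over \<open>j \<noteq> s\<close>.  Expanding \<open>\<kappa>\<^sub>i\<^sub>j\<close> in powers of
  \<open>x\<^sub>i x\<^sub>j\<close>, each power then contributes an instance of the Cauchy-Schwarz inequality for the positive semidefinite
  matrix \<open>k\<close> (lemmas \<open>log_kernel_Cauchy_Schwarz\<close>, \<open>normalized_entropy_inequality\<close> and
  \<open>kernel_entropy_inequality\<close>).

  It remains to compare \<open>\<alpha> h(w\<^sub>i)\<close>, which is some logarithm of \<open>u\<^sub>i\<close>, with the principal one.
  If all \<open>u\<^sub>i\<close> lie in the right half-plane, then so does the whole image of each segment from \<open>w\<^sub>s\<close>
  to \<open>w\<^sub>i\<close>, hence the two logarithms differ by the same multiple \<open>2 \<pi> i m\<close> for all nodes, and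
  \<open>Re (2 \<pi> i m E) = 0\<close>.  If all coefficients are real, then \<open>cnj c\<^sub>i u\<^sub>i\<close> is real and only
  \<open>ln |u\<^sub>i|\<close> enters.
\<close>

section \<open>Positive semidefiniteness of the real kernels\<close>

lemma quadratic_form_Cauchy_Schwarz:
  fixes M :: "'a \<Rightarrow> 'a \<Rightarrow> real"
  assumes sym: "\<And>i j. i \<in> A \<Longrightarrow> j \<in> A \<Longrightarrow> M i j = M j i"
    and psd: "\<And>a. (\<Sum>i\<in>A. \<Sum>j\<in>A. a i * a j * M i j) \<ge> 0"
  shows "(\<Sum>i\<in>A. \<Sum>j\<in>A. a i * b j * M i j)\<^sup>2
    \<le> (\<Sum>i\<in>A. \<Sum>j\<in>A. a i * a j * M i j) * (\<Sum>i\<in>A. \<Sum>j\<in>A. b i * b j * M i j)"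
proof -
  define Q where "Q a b = (\<Sum>i\<in>A. \<Sum>j\<in>A. a i * b j * M i j)" for a b :: "'a \<Rightarrow> real"
  have Qsym: "Q a b = Q b a" for a b
  proof -
    have "Q a b = (\<Sum>j\<in>A. \<Sum>i\<in>A. a i * b j * M i j)"
      unfolding Q_def by (rule sum.swap)
    also have "\<dots> = Q b a"
      unfolding Q_def by (intro sum.cong refl) (simp add: sym mult_ac)
    finally show ?thesis .
  qed
  have expand: "Q (\<lambda>i. a i + t * b i) (\<lambda>i. a i + t * b i) = Q a a + 2 * t * Q a b + t\<^sup>2 * Q b b" for t
  proof -
    have "Q (\<lambda>i. a i + t * b i) (\<lambda>i. a i + t * b i) = Q a a + t * Q a b + t * Q b a + t\<^sup>2 * Q b b"
      unfolding Q_def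
      by (simp add: sum.distrib sum_distrib_left algebra_simps power2_eq_square)
    then show ?thesis by (simp add: Qsym[of b a])
  qed
  have nonneg: "Q a a + 2 * t * Q a b + t\<^sup>2 * Q b b \<ge> 0" for t
    using psd[of "\<lambda>i. a i + t * b i"] expand[of t] unfolding Q_def by simp
  have bb: "Q b b \<ge> 0" using psd unfolding Q_def .
  have "(Q a b)\<^sup>2 \<le> Q a a * Q b b"
  proof (cases "Q b b = 0")
    case True
    have "Q a b = 0"
    proof (rule ccontr)
      assume ne: "Q a b \<noteq> 0"
      show False
        using nonneg[of "- (Q a a + 1) / (2 * Q a b)"] True ne by (simp add: field_simps)
    qed
    then show ?thesis using True by simp
  next
    case False
    then have pos: "Q b b > 0" using bb by simp
    have "Q a a + 2 * (- Q a b / Q b b) * Q a b + (- Q a b / Q b b)\<^sup>2 * Q b b \<ge> 0" by (rule nonneg)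
    then have "Q a a - (Q a b)\<^sup>2 / Q b b \<ge> 0"
      using pos by (simp add: field_simps power2_eq_square)
    then show ?thesis using pos by (simp add: field_simps)
  qed
  then show ?thesis unfolding Q_def .
qed

text \<open>
  The Pochhammer form has visibly nonnegative coefficients for \<open>a \<ge> 0\<close>, and these coefficients
  are the reciprocals of the moments of the Bergman measures below.
\<close>

lemma negative_binomial_sums_complex:
  fixes z :: complex
  assumes "norm z < 1"
  shows "(\<lambda>n. pochhammer a n / fact n * z ^ n) sums (1 - z) powr (- a)"
proof -
  have "(\<lambda>n. ((- a) gchoose n) * (- z) ^ n) sums (1 + - z) powr (- a)"
    by (rule gen_binomial_complex) (use assms in simp)
  moreover have "((- a) gchoose n) * (- z) ^ n = pochhammer a n / fact n * z ^ n" for n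
  proof -
    have "((- a) gchoose n) * (- z) ^ n = ((-1) ^ n * (-1) ^ n) * (pochhammer a n / fact n * z ^ n)"
      by (simp add: gbinomial_pochhammer power_minus[of z])
    then show ?thesis by (simp flip: power_mult_distrib)
  qed
  ultimately show ?thesis by simp
qed

lemma negative_binomial_sums_real:
  fixes x :: real
  assumes "\<bar>x\<bar> < 1"
  shows "(\<lambda>n. pochhammer a n / fact n * x ^ n) sums (1 - x) powr (- a)"
proof -
  have "(\<lambda>n. ((- a) gchoose n) * (- x) ^ n) sums (1 + - x) powr (- a)"
    by (rule gen_binomial_real) (use assms in simp)
  moreover have "((- a) gchoose n) * (- x) ^ n = pochhammer a n / fact n * x ^ n" for n
  proof -
    have "((- a) gchoose n) * (- x) ^ n = ((-1) ^ n * (-1) ^ n) * (pochhammer a n / fact n * x ^ n)"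
      by (simp add: gbinomial_pochhammer power_minus[of x])
    then show ?thesis by (simp flip: power_mult_distrib)
  qed
  ultimately show ?thesis by simp
qed

text \<open>
  In the expansion in powers of \<open>x\<^sub>i x\<^sub>j\<close> the quadratic form becomes a nonnegative combination of the
  squares \<open>(\<Sum>\<^sub>i a\<^sub>i x\<^sub>i ^ n)\<^sup>2\<close>; subtracting \<open>1\<close> removes the term \<open>n = 0\<close>.
\<close>

lemma binomial_kernel_psd:
  fixes x a :: "'i \<Rightarrow> real"
  assumes x: "\<And>i. i \<in> A \<Longrightarrow> \<bar>x i\<bar> < 1" and \<beta>: "\<beta> \<ge> 0"
  shows "(\<Sum>i\<in>A. \<Sum>j\<in>A. a i * a j * ((1 - x i * x j) powr (- \<beta>) - 1)) \<ge> 0"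
proof -
  let ?t = "\<lambda>n. pochhammer \<beta> n / fact n * (\<Sum>i\<in>A. a i * x i ^ n)\<^sup>2"
  have xx: "\<bar>x i * x j\<bar> < 1" if "i \<in> A" "j \<in> A" for i j
    using x[OF that(1)] x[OF that(2)] by (metis abs_mult abs_ge_zero mult_strict_mono' mult.right_neutral)
  have "(\<lambda>n. \<Sum>i\<in>A. \<Sum>j\<in>A. a i * a j * (pochhammer \<beta> n / fact n * (x i * x j) ^ n))
      sums (\<Sum>i\<in>A. \<Sum>j\<in>A. a i * a j * (1 - x i * x j) powr (- \<beta>))"
    by (intro sums_sum sums_mult negative_binomial_sums_real xx)
  moreover have "(\<Sum>i\<in>A. \<Sum>j\<in>A. a i * a j * (pochhammer \<beta> n / fact n * (x i * x j) ^ n)) = ?t n" for n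
    by (simp add: power2_eq_square sum_product sum_distrib_left power_mult_distrib mult_ac)
  ultimately have S: "?t sums (\<Sum>i\<in>A. \<Sum>j\<in>A. a i * a j * (1 - x i * x j) powr (- \<beta>))" by simp
  have "sum ?t {..<1} \<le> suminf ?t"
  proof (rule sum_le_suminf)
    have "pochhammer \<beta> n \<ge> 0" for n
      unfolding pochhammer_prod by (rule prod_nonneg) (use \<beta> in auto)
    then show "0 \<le> ?t n" for n by simp
  qed (use S in \<open>auto simp: sums_iff\<close>)
  then have "(\<Sum>i\<in>A. a i)\<^sup>2 \<le> (\<Sum>i\<in>A. \<Sum>j\<in>A. a i * a j * (1 - x i * x j) powr (- \<beta>))"
    using S by (simp add: sums_iff)
  then show ?thesis
    by (simp add: power2_eq_square sum_product algebra_simps sum_subtractf)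
qed

lemma neg_ln_sums:
  fixes x :: real
  assumes "\<bar>x\<bar> < 1"
  shows "(\<lambda>n. x ^ Suc n / real (Suc n)) sums (- ln (1 - x))"
proof -
  have "(\<lambda>n. - (- ((- (- x)) ^ n) / of_nat n)) sums (- ln (1 + - x))"
    by (rule sums_minus, rule ln_series') (use assms in simp)
  then have "(\<lambda>n. x ^ n / real n) sums (- ln (1 - x))" by simp
  then show ?thesis
    using sums_Suc_iff[of "\<lambda>n. x ^ n / real n" "- ln (1 - x)"] by simp
qed

text \<open>
  The quantity \<open>U i\<close> is the pairing, in the form \<open>k\<close>, of the unit vector at \<open>i\<close> with a vector of
  square length \<open>E\<close> that has one further entry at a node \<open>x = 0\<close>.  Hence \<open>(\<Sum>\<^sub>i a\<^sub>i U\<^sub>i)\<^sup>2\<close> is at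
  most \<open>E\<close> times the form at \<open>a\<close>.  The choices \<open>a\<^sub>i = r\<^sub>i x\<^sub>i ^ n\<close>, summed with the weights \<open>1 / n\<close>
  of the logarithmic series, give the claim.  The further entry is kept separate as \<open>P\<close>, so that
  only the form \<open>k - 1\<close> on \<open>A\<close> occurs.
\<close>

lemma log_kernel_Cauchy_Schwarz:
  fixes x r :: "'i \<Rightarrow> real" and P \<beta> :: real
  assumes x: "\<And>i. i \<in> A \<Longrightarrow> \<bar>x i\<bar> < 1" and \<beta>: "\<beta> \<ge> 0"
  defines "k \<equiv> \<lambda>i j. (1 - x i * x j) powr (- \<beta>)"
    and "\<kappa> \<equiv> \<lambda>i j. - ln (1 - x i * x j)"
  defines "U \<equiv> \<lambda>i. P + (\<Sum>j\<in>A. r j * (k i j - 1))"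
    and "E \<equiv> P\<^sup>2 + (\<Sum>i\<in>A. \<Sum>j\<in>A. r i * r j * (k i j - 1))"
  shows "(\<Sum>i\<in>A. \<Sum>j\<in>A. r i * r j * \<kappa> i j * (U i * U j)) \<le> E * (\<Sum>i\<in>A. \<Sum>j\<in>A. r i * r j * \<kappa> i j * k i j)"
proof -
  define Q where "Q a b = (\<Sum>i\<in>A. \<Sum>j\<in>A. a i * b j * (k i j - 1))" for a b :: "'i \<Rightarrow> real"
  have psd: "Q a a \<ge> 0" for a
    unfolding Q_def k_def by (rule binomial_kernel_psd[OF x \<beta>])
  have CS: "(Q a b)\<^sup>2 \<le> Q a a * Q b b" for a b
    unfolding Q_def
  proof (rule quadratic_form_Cauchy_Schwarz)
    show "k i j - 1 = k j i - 1" for i j by (simp add: k_def mult.commute)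
  qed (use psd Q_def in simp)
  have key: "(\<Sum>i\<in>A. a i * U i)\<^sup>2 \<le> E * (\<Sum>i\<in>A. \<Sum>j\<in>A. a i * a j * k i j)" for a
  proof -
    define s where "s = (\<Sum>i\<in>A. a i)"
    have 1: "(\<Sum>i\<in>A. a i * U i) = P * s + Q a r"
      by (simp add: U_def s_def Q_def distrib_left sum.distrib sum_distrib_left mult_ac)
    have 2: "(\<Sum>i\<in>A. \<Sum>j\<in>A. a i * a j * k i j) = s\<^sup>2 + Q a a"
      by (simp add: s_def Q_def power2_eq_square sum_product right_diff_distrib sum_subtractf)
    have 3: "E = P\<^sup>2 + Q r r" by (simp add: E_def Q_def)
    have "2 * P * s * Q a r \<le> P\<^sup>2 * Q a a + s\<^sup>2 * Q r r"
    proof -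
      have "\<bar>Q a r\<bar> \<le> sqrt (Q a a) * sqrt (Q r r)"
        using real_sqrt_le_mono[OF CS[of a r]] by (simp add: real_sqrt_mult)
      then have "\<bar>P * s\<bar> * \<bar>Q a r\<bar> \<le> \<bar>P * s\<bar> * (sqrt (Q a a) * sqrt (Q r r))"
        by (rule mult_left_mono) simp
      moreover have "P * s * Q a r \<le> \<bar>P * s\<bar> * \<bar>Q a r\<bar>"
        by (metis abs_ge_self abs_mult)
      ultimately have "2 * P * s * Q a r \<le> 2 * \<bar>P * s\<bar> * (sqrt (Q a a) * sqrt (Q r r))"
        by simp
      also have "\<dots> = 2 * (\<bar>P\<bar> * sqrt (Q a a)) * (\<bar>s\<bar> * sqrt (Q r r))" by (simp add: abs_mult)
      also have "\<dots> \<le> (\<bar>P\<bar> * sqrt (Q a a))\<^sup>2 + (\<bar>s\<bar> * sqrt (Q r r))\<^sup>2"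
        by (rule sum_squares_bound)
      also have "\<dots> = P\<^sup>2 * Q a a + s\<^sup>2 * Q r r"
        using psd by (simp add: power_mult_distrib)
      finally show ?thesis .
    qed
    then show ?thesis
      using CS[of a r] unfolding 1 2 3 by (simp add: power2_eq_square algebra_simps)
  qed
  have xx: "\<bar>x i * x j\<bar> < 1" if "i \<in> A" "j \<in> A" for i j
    using x[OF that(1)] x[OF that(2)] by (metis abs_mult abs_ge_zero mult_strict_mono' mult.right_neutral)
  have S: "(\<lambda>n. \<Sum>i\<in>A. \<Sum>j\<in>A. r i * r j * ((x i * x j) ^ Suc n / real (Suc n)) * G i j)
      sums (\<Sum>i\<in>A. \<Sum>j\<in>A. r i * r j * \<kappa> i j * G i j)" for G
    unfolding \<kappa>_def by (intro sums_sum sums_mult sums_mult2 neg_ln_sums xx)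
  show ?thesis
  proof (rule sums_le[OF _ S sums_mult[OF S]])
    fix n
    let ?a = "\<lambda>i. r i * x i ^ Suc n"
    have "(\<Sum>i\<in>A. \<Sum>j\<in>A. r i * r j * ((x i * x j) ^ Suc n / real (Suc n)) * (U i * U j))
        = (\<Sum>i\<in>A. ?a i * U i)\<^sup>2 / real (Suc n)"
      by (simp add: power2_eq_square sum_product sum_divide_distrib power_mult_distrib mult_ac del: power_Suc of_nat_Suc)
    also have "\<dots> \<le> E * (\<Sum>i\<in>A. \<Sum>j\<in>A. ?a i * ?a j * k i j) / real (Suc n)"
      by (intro divide_right_mono key) simp
    also have "\<dots> = E * (\<Sum>i\<in>A. \<Sum>j\<in>A. r i * r j * ((x i * x j) ^ Suc n / real (Suc n)) * k i j)"
      by (simp add: sum_divide_distrib sum_distrib_left power_mult_distrib mult_ac del: power_Suc of_nat_Suc)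
    finally show "(\<Sum>i\<in>A. \<Sum>j\<in>A. r i * r j * ((x i * x j) ^ Suc n / real (Suc n)) * (U i * U j))
      \<le> E * (\<Sum>i\<in>A. \<Sum>j\<in>A. r i * r j * ((x i * x j) ^ Suc n / real (Suc n)) * k i j)" .
  qed
qed

section \<open>The entropy inequality for normalized kernels\<close>

lemma has_vector_derivative_mult_Ln:
  assumes u: "(u has_vector_derivative u') (at \<beta>)" and pos: "u \<beta> \<notin> \<real>\<^sub>\<le>\<^sub>0"
  shows "((\<lambda>\<beta>. u \<beta> * Ln (u \<beta>)) has_vector_derivative u' * (Ln (u \<beta>) + 1)) (at \<beta>)"
proof -
  have ne: "u \<beta> \<noteq> 0" using pos by auto
  have "((\<lambda>z. z * Ln z) has_field_derivative (Ln (u \<beta>) + 1)) (at (u \<beta>))"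
    by (rule derivative_eq_intros refl pos)+ (use ne in simp)
  from field_vector_diff_chain_at[OF u this] show ?thesis
    by (simp add: o_def)
qed

text \<open>
  The bound \<open>- ln y \<ge> 1 - y\<close> with \<open>y = U\<^sub>i U\<^sub>j / (k\<^sub>i\<^sub>j E)\<close> has nonnegative weights here, so the sum of
  logarithms is at least the difference of the two sides of \<open>log_kernel_Cauchy_Schwarz\<close>, divided
  by \<open>E\<close>.
\<close>

lemma log_derivative_nonneg:
  fixes x r :: "'i \<Rightarrow> real" and P \<beta> :: real
  assumes x: "\<And>i. i \<in> A \<Longrightarrow> \<bar>x i\<bar> < 1" and same: "\<And>i j. i \<in> A \<Longrightarrow> j \<in> A \<Longrightarrow> 0 \<le> x i * x j"
    and r: "\<And>i. i \<in> A \<Longrightarrow> 0 \<le> r i" and P: "P > 0" and \<beta>: "\<beta> \<ge> 0"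
  defines "k \<equiv> \<lambda>i j. (1 - x i * x j) powr (- \<beta>)"
    and "\<kappa> \<equiv> \<lambda>i j. - ln (1 - x i * x j)"
  defines "U \<equiv> \<lambda>i. P + (\<Sum>j\<in>A. r j * (k i j - 1))"
    and "E \<equiv> P\<^sup>2 + (\<Sum>i\<in>A. \<Sum>j\<in>A. r i * r j * (k i j - 1))"
  shows "0 \<le> (\<Sum>i\<in>A. \<Sum>j\<in>A. r i * r j * \<kappa> i j * k i j * (\<beta> * \<kappa> i j + ln E - ln (U i) - ln (U j)))"
proof -
  have xx: "x i * x j < 1" if "i \<in> A" "j \<in> A" for i j
    using abs_mult_less[OF x[OF that(1)] x[OF that(2)]] by (simp add: abs_mult[symmetric])
  have \<kappa>: "\<kappa> i j \<ge> 0" if "i \<in> A" "j \<in> A" for i j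
    unfolding \<kappa>_def using xx[OF that] same[OF that] by simp
  have k_exp: "k i j = exp (\<beta> * \<kappa> i j)" if "i \<in> A" "j \<in> A" for i j
    unfolding k_def \<kappa>_def powr_def using xx[OF that] by simp
  have k1: "k i j \<ge> 1" if "i \<in> A" "j \<in> A" for i j
    using k_exp[OF that] \<kappa>[OF that] \<beta> by simp
  have U: "U i > 0" if "i \<in> A" for i
    unfolding U_def using P by (intro add_pos_nonneg sum_nonneg mult_nonneg_nonneg r) (use k1 that in auto)
  have E: "E > 0"
    unfolding E_def using P by (intro add_pos_nonneg sum_nonneg mult_nonneg_nonneg r) (use k1 in auto)
  have "E * (\<Sum>i\<in>A. \<Sum>j\<in>A. r i * r j * \<kappa> i j * (k i j - U i * U j / E))
      = E * (\<Sum>i\<in>A. \<Sum>j\<in>A. r i * r j * \<kappa> i j * k i j) - (\<Sum>i\<in>A. \<Sum>j\<in>A. r i * r j * \<kappa> i j * (U i * U j))"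
    using E by (simp add: right_diff_distrib sum_subtractf sum_distrib_left)
  also have "\<dots> \<ge> 0"
  proof -
    have "(\<Sum>i\<in>A. \<Sum>j\<in>A. r i * r j * \<kappa> i j * (U i * U j)) \<le> E * (\<Sum>i\<in>A. \<Sum>j\<in>A. r i * r j * \<kappa> i j * k i j)"
      unfolding U_def E_def k_def \<kappa>_def by (rule log_kernel_Cauchy_Schwarz) (use x \<beta> in auto)
    then show ?thesis by simp
  qed
  finally have "0 \<le> (\<Sum>i\<in>A. \<Sum>j\<in>A. r i * r j * \<kappa> i j * (k i j - U i * U j / E))"
    using E by (simp add: zero_le_mult_iff)
  also have "\<dots> \<le> (\<Sum>i\<in>A. \<Sum>j\<in>A. r i * r j * \<kappa> i j * k i j * (\<beta> * \<kappa> i j + ln E - ln (U i) - ln (U j)))"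
  proof (intro sum_mono)
    fix i j assume ij: "i \<in> A" "j \<in> A"
    define y where "y = U i * U j / (k i j * E)"
    have kpos: "k i j > 0" using k1[OF ij] by simp
    have y: "y > 0" unfolding y_def using U[OF ij(1)] U[OF ij(2)] E kpos by simp
    have "ln y = ln (U i) + ln (U j) - (\<beta> * \<kappa> i j + ln E)"
      unfolding y_def using U[OF ij(1)] U[OF ij(2)] E kpos by (simp add: ln_div ln_mult k_exp[OF ij])
    with ln_le_minus_one[OF y] have "1 - y \<le> \<beta> * \<kappa> i j + ln E - ln (U i) - ln (U j)" by simp
    then have "r i * r j * \<kappa> i j * k i j * (1 - y) \<le> r i * r j * \<kappa> i j * k i j * (\<beta> * \<kappa> i j + ln E - ln (U i) - ln (U j))"
      by (rule mult_left_mono) (use r ij \<kappa> kpos in simp)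
    moreover have "k i j * (1 - y) = k i j - U i * U j / E"
      unfolding y_def using kpos E by (simp add: field_simps)
    ultimately show "r i * r j * \<kappa> i j * (k i j - U i * U j / E) \<le> r i * r j * \<kappa> i j * k i j * (\<beta> * \<kappa> i j + ln E - ln (U i) - ln (U j))"
      by (simp add: mult.assoc)
  qed
  finally show ?thesis .
qed

text \<open>
  This is the entropy inequality when the distinguished node is \<open>0\<close>.  Its value is \<open>p\<close>, its
  coefficient is \<open>p - \<sigma> S\<close> with \<open>S\<close> the sum of the \<open>r i\<close>, and \<open>A\<close> indexes the remaining nodes.
  The proof lets the exponent grow from \<open>0\<close> to \<open>\<alpha>\<close>.  Each value \<open>v \<beta> i\<close> then moves from \<open>p\<close> to \<open>u i\<close>
  along a straight line of direction \<open>\<sigma>\<close>, so it stays in the half-plane, where \<open>Ln\<close> is smooth.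
\<close>

lemma normalized_entropy_inequality:
  fixes x r :: "'i \<Rightarrow> real" and p \<sigma> :: complex and \<alpha> :: real
  assumes x: "\<And>i. i \<in> A \<Longrightarrow> \<bar>x i\<bar> < 1" and same: "\<And>i j. i \<in> A \<Longrightarrow> j \<in> A \<Longrightarrow> 0 \<le> x i * x j"
    and r: "\<And>i. i \<in> A \<Longrightarrow> 0 \<le> r i" and \<sigma>: "norm \<sigma> = 1" and p: "Re p > 0" and \<alpha>: "\<alpha> \<ge> 0"
  defines "k \<equiv> \<lambda>i j. (1 - x i * x j) powr (- \<alpha>)"
  defines "u \<equiv> \<lambda>i. p + \<sigma> * of_real (\<Sum>j\<in>A. r j * (k i j - 1))"
    and "E \<equiv> (norm p)\<^sup>2 + (\<Sum>i\<in>A. \<Sum>j\<in>A. r i * r j * (k i j - 1))"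
  assumes u: "\<And>i. i \<in> A \<Longrightarrow> Re (u i) > 0"
  shows "2 * Re ((cnj p - cnj \<sigma> * of_real (\<Sum>i\<in>A. r i)) * (p * Ln p)
           + (\<Sum>i\<in>A. of_real (r i) * (cnj \<sigma> * (u i * Ln (u i)))))
      \<le> (\<Sum>i\<in>A. \<Sum>j\<in>A. r i * r j * (k i j * ln (k i j))) + E * ln E"
proof -
  define \<kappa> where "\<kappa> i j = - ln (1 - x i * x j)" for i j
  define kk where "kk \<beta> i j = exp (\<beta> * \<kappa> i j)" for \<beta> i j
  define d where "d \<beta> i = (\<Sum>j\<in>A. r j * (kk \<beta> i j - 1))" for \<beta> i
  define d' where "d' \<beta> i = (\<Sum>j\<in>A. r j * (\<kappa> i j * kk \<beta> i j))" for \<beta> i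
  define v where "v \<beta> i = p + \<sigma> * of_real (d \<beta> i)" for \<beta> i
  define EE where "EE \<beta> = (norm p)\<^sup>2 + (\<Sum>i\<in>A. r i * d \<beta> i)" for \<beta>
  define S where "S = (\<Sum>i\<in>A. r i)"
  define \<Psi> where "\<Psi> \<beta> i = Re (cnj \<sigma> * (v \<beta> i * Ln (v \<beta> i)))" for \<beta> i
  define \<Phi> where "\<Phi> \<beta> = (\<Sum>i\<in>A. \<Sum>j\<in>A. r i * r j * (kk \<beta> i j * (\<beta> * \<kappa> i j))) + EE \<beta> * ln (EE \<beta>)
      - 2 * (Re ((cnj p - cnj \<sigma> * of_real S) * (p * Ln p)) + (\<Sum>i\<in>A. r i * \<Psi> \<beta> i))" for \<beta>
  have pn: "norm p > 0" using p by auto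
  have xx: "x i * x j < 1" if "i \<in> A" "j \<in> A" for i j
    using abs_mult_less[OF x[OF that(1)] x[OF that(2)]] by (simp add: abs_mult[symmetric])
  have \<kappa>: "\<kappa> i j \<ge> 0" if "i \<in> A" "j \<in> A" for i j
    unfolding \<kappa>_def using xx[OF that] same[OF that] by simp
  have kk_powr: "(1 - x i * x j) powr (- \<beta>) = kk \<beta> i j" if "i \<in> A" "j \<in> A" for i j \<beta>
    unfolding kk_def \<kappa>_def powr_def using xx[OF that] by simp
  have k: "k i j = kk \<alpha> i j" if "i \<in> A" "j \<in> A" for i j
    unfolding k_def by (rule kk_powr[OF that])
  have kk_mono: "kk \<beta> i j \<le> kk \<gamma> i j" if "i \<in> A" "j \<in> A" "\<beta> \<le> \<gamma>" for i j \<beta> \<gamma>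
    unfolding kk_def using \<kappa>[OF that(1,2)] that(3) by (simp add: mult_right_mono)
  have kk1: "kk \<beta> i j \<ge> 1" if "i \<in> A" "j \<in> A" "\<beta> \<ge> 0" for i j \<beta>
    unfolding kk_def using \<kappa>[OF that(1,2)] that(3) by simp
  have d_mono: "d \<beta> i \<le> d \<gamma> i" if "i \<in> A" "\<beta> \<le> \<gamma>" for i \<beta> \<gamma>
    unfolding d_def by (intro sum_mono mult_left_mono diff_right_mono kk_mono r) (use that in auto)
  have d_nonneg: "d \<beta> i \<ge> 0" if "i \<in> A" "\<beta> \<ge> 0" for i \<beta>
    unfolding d_def by (intro sum_nonneg mult_nonneg_nonneg r) (use kk1 that in auto)
  have u_eq: "u i = v \<alpha> i" if "i \<in> A" for i
    unfolding u_def v_def d_def using k that by simp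
  have v_pos: "Re (v \<beta> i) > 0" if "i \<in> A" "0 \<le> \<beta>" "\<beta> \<le> \<alpha>" for i \<beta>
  proof (cases "Re \<sigma> \<ge> 0")
    case True
    then have "Re \<sigma> * d \<beta> i \<ge> 0" using d_nonneg that by simp
    then show ?thesis using p by (simp add: v_def)
  next
    case False
    then have "Re \<sigma> * d \<alpha> i \<le> Re \<sigma> * d \<beta> i"
      using d_mono[of i \<beta> \<alpha>] that by (simp add: mult_left_mono_neg)
    moreover have "Re (v \<alpha> i) > 0" using u[OF that(1)] u_eq[OF that(1)] by simp
    ultimately show ?thesis by (simp add: v_def)
  qed
  have EE_pos: "EE \<beta> > 0" if "\<beta> \<ge> 0" for \<beta>
    unfolding EE_def using pn that by (intro add_pos_nonneg sum_nonneg mult_nonneg_nonneg r d_nonneg) auto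
  have \<sigma>\<sigma>: "cnj \<sigma> * \<sigma> = 1" using \<sigma> by (simp add: complex_norm_square[symmetric] mult.commute)
  have deriv: "(\<Phi> has_real_derivative
      (\<Sum>i\<in>A. \<Sum>j\<in>A. r i * r j * \<kappa> i j * kk \<beta> i j *
          (\<beta> * \<kappa> i j + ln (EE \<beta>) - ln (norm (v \<beta> i)) - ln (norm (v \<beta> j))))) (at \<beta>)"
    if \<beta>: "0 \<le> \<beta>" "\<beta> \<le> \<alpha>" for \<beta>
  proof -
    have dkk: "((\<lambda>\<beta>. kk \<beta> i j) has_real_derivative \<kappa> i j * kk \<beta> i j) (at \<beta>)" for i j
      unfolding kk_def by (auto intro!: derivative_eq_intros)
    have dd: "((\<lambda>\<beta>. d \<beta> i) has_real_derivative d' \<beta> i) (at \<beta>)" for i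
      unfolding d_def d'_def by (auto intro!: derivative_eq_intros dkk simp: mult_ac)
    have d\<Psi>: "((\<lambda>\<beta>. \<Psi> \<beta> i) has_real_derivative d' \<beta> i * (ln (norm (v \<beta> i)) + 1)) (at \<beta>)" if "i \<in> A" for i
    proof -
      have vpos: "Re (v \<beta> i) > 0" using v_pos[OF that \<beta>] .
      have "((\<lambda>\<beta>. v \<beta> i) has_vector_derivative \<sigma> * of_real (d' \<beta> i)) (at \<beta>)"
        unfolding v_def
        by (auto intro!: derivative_eq_intros has_vector_derivative_of_real dd
            simp: has_real_derivative_iff_has_vector_derivative[symmetric])
      then have "((\<lambda>\<beta>. v \<beta> i * Ln (v \<beta> i)) has_vector_derivative
          \<sigma> * of_real (d' \<beta> i) * (Ln (v \<beta> i) + 1)) (at \<beta>)"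
        by (rule has_vector_derivative_mult_Ln) (use vpos in \<open>auto simp: complex_nonpos_Reals_iff\<close>)
      then have "((\<lambda>\<beta>. Re (cnj \<sigma> * (v \<beta> i * Ln (v \<beta> i)))) has_vector_derivative
          Re (cnj \<sigma> * (\<sigma> * of_real (d' \<beta> i) * (Ln (v \<beta> i) + 1)))) (at \<beta>)"
        by (intro bounded_linear.has_vector_derivative[OF bounded_linear_Re]
            bounded_linear.has_vector_derivative[OF bounded_linear_mult_right])
      moreover have "cnj \<sigma> * (\<sigma> * of_real (d' \<beta> i) * (Ln (v \<beta> i) + 1)) = of_real (d' \<beta> i) * (Ln (v \<beta> i) + 1)"
        using \<sigma>\<sigma> by (metis mult.assoc mult_1)
      moreover have "v \<beta> i \<noteq> 0" using vpos by auto
      ultimately show ?thesis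
        unfolding \<Psi>_def has_real_derivative_iff_has_vector_derivative by simp
    qed
    have "(\<Phi> has_real_derivative
       (\<Sum>i\<in>A. \<Sum>j\<in>A. r i * r j * (\<kappa> i j * kk \<beta> i j * (\<beta> * \<kappa> i j) + kk \<beta> i j * \<kappa> i j))
       + ((\<Sum>i\<in>A. r i * d' \<beta> i) * ln (EE \<beta>) + (\<Sum>i\<in>A. r i * d' \<beta> i))
       - 2 * (\<Sum>i\<in>A. r i * (d' \<beta> i * (ln (norm (v \<beta> i)) + 1)))) (at \<beta>)"
      unfolding \<Phi>_def
    proof (intro DERIV_diff DERIV_add DERIV_sum DERIV_cmult)
      show "((\<lambda>\<beta>. kk \<beta> i j * (\<beta> * \<kappa> i j)) has_real_derivative
          \<kappa> i j * kk \<beta> i j * (\<beta> * \<kappa> i j) + kk \<beta> i j * \<kappa> i j) (at \<beta>)" for i j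
        by (auto intro!: derivative_eq_intros dkk)
      have dE: "(EE has_real_derivative (\<Sum>i\<in>A. r i * d' \<beta> i)) (at \<beta>)"
        unfolding EE_def by (auto intro!: derivative_eq_intros dd simp: mult.commute)
      show "((\<lambda>\<beta>. EE \<beta> * ln (EE \<beta>)) has_real_derivative
          (\<Sum>i\<in>A. r i * d' \<beta> i) * ln (EE \<beta>) + (\<Sum>i\<in>A. r i * d' \<beta> i)) (at \<beta>)"
        using EE_pos[OF \<beta>(1)] by (auto intro!: derivative_eq_intros dE)
      show "((\<lambda>\<beta>. Re ((cnj p - cnj \<sigma> * of_real S) * (p * Ln p)) + (\<Sum>i\<in>A. r i * \<Psi> \<beta> i)) has_real_derivative
          (\<Sum>i\<in>A. r i * (d' \<beta> i * (ln (norm (v \<beta> i)) + 1)))) (at \<beta>)"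
        by (rule DERIV_cong, rule DERIV_add[OF DERIV_const DERIV_sum], rule DERIV_cmult, rule d\<Psi>) auto
    qed
    moreover have "(\<Sum>i\<in>A. \<Sum>j\<in>A. r i * r j * (\<kappa> i j * kk \<beta> i j * (\<beta> * \<kappa> i j) + kk \<beta> i j * \<kappa> i j))
       + ((\<Sum>i\<in>A. r i * d' \<beta> i) * ln (EE \<beta>) + (\<Sum>i\<in>A. r i * d' \<beta> i))
       - 2 * (\<Sum>i\<in>A. r i * (d' \<beta> i * (ln (norm (v \<beta> i)) + 1)))
       = (\<Sum>i\<in>A. \<Sum>j\<in>A. r i * r j * \<kappa> i j * kk \<beta> i j *
          (\<beta> * \<kappa> i j + ln (EE \<beta>) - ln (norm (v \<beta> i)) - ln (norm (v \<beta> j))))" (is "?L = ?R")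
    proof -
      define W where "W i j = r i * r j * (\<kappa> i j * kk \<beta> i j)" for i j
      have Wsym: "W i j = W j i" for i j
        by (simp add: W_def \<kappa>_def kk_def mult.commute)
      have 1: "(\<Sum>i\<in>A. r i * (d' \<beta> i * g i)) = (\<Sum>i\<in>A. \<Sum>j\<in>A. W i j * g i)" for g
        by (simp add: d'_def W_def sum_distrib_left sum_distrib_right mult_ac)
      have 2: "(\<Sum>i\<in>A. \<Sum>j\<in>A. W i j * g i) = (\<Sum>i\<in>A. \<Sum>j\<in>A. W i j * g j)" for g
        by (subst sum.swap) (simp add: Wsym)
      let ?l = "\<lambda>i. ln (norm (v \<beta> i))"
      have "?L = (\<Sum>i\<in>A. \<Sum>j\<in>A. W i j * (\<beta> * \<kappa> i j + 1)) + (\<Sum>i\<in>A. \<Sum>j\<in>A. W i j) * ln (EE \<beta>)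
          + (\<Sum>i\<in>A. \<Sum>j\<in>A. W i j) - ((\<Sum>i\<in>A. \<Sum>j\<in>A. W i j * (?l i + 1)) + (\<Sum>i\<in>A. \<Sum>j\<in>A. W i j * (?l j + 1)))"
        using 1[of "\<lambda>_. 1"] 1[of "\<lambda>i. ?l i + 1"] 2[of "\<lambda>i. ?l i + 1"]
        by (simp add: W_def algebra_simps)
      also have "\<dots> = (\<Sum>i\<in>A. \<Sum>j\<in>A. W i j * (\<beta> * \<kappa> i j + 1) + W i j * ln (EE \<beta>) + W i j - (W i j * (?l i + 1) + W i j * (?l j + 1)))"
        by (simp only: sum.distrib sum_subtractf sum_distrib_right)
      also have "\<dots> = ?R"
        by (intro sum.cong refl) (simp add: W_def algebra_simps)
      finally show ?thesis .
    qed
    ultimately show ?thesis by simp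
  qed
  \<comment> \<open>Replacing \<open>norm (v \<beta> i)\<close> by the larger \<open>norm p + d \<beta> i\<close> reduces complex phases to the case
    of a positive \<open>P = norm p\<close>; the square length \<open>EE \<beta>\<close> depends on \<open>norm p\<close> only.\<close>
  have nonneg: "0 \<le> (\<Sum>i\<in>A. \<Sum>j\<in>A. r i * r j * \<kappa> i j * kk \<beta> i j *
          (\<beta> * \<kappa> i j + ln (EE \<beta>) - ln (norm (v \<beta> i)) - ln (norm (v \<beta> j))))"
    if \<beta>: "0 \<le> \<beta>" "\<beta> \<le> \<alpha>" for \<beta>
  proof -
    define U where "U i = norm p + d \<beta> i" for i
    have "0 \<le> (\<Sum>i\<in>A. \<Sum>j\<in>A. r i * r j * \<kappa> i j * kk \<beta> i j * (\<beta> * \<kappa> i j + ln (EE \<beta>) - ln (U i) - ln (U j)))"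
    proof -
      have eq: "(\<Sum>i\<in>A. \<Sum>j\<in>A. r i * r j * (kk \<beta> i j - 1)) = (\<Sum>i\<in>A. r i * d \<beta> i)"
        by (simp add: d_def sum_distrib_left mult.assoc)
      show ?thesis
        using log_derivative_nonneg[of A x r "norm p" \<beta>, OF x same r pn \<beta>(1)]
        by (simp add: kk_powr U_def EE_def \<kappa>_def eq d_def[symmetric])
    qed
    also have "\<dots> \<le> (\<Sum>i\<in>A. \<Sum>j\<in>A. r i * r j * \<kappa> i j * kk \<beta> i j *
          (\<beta> * \<kappa> i j + ln (EE \<beta>) - ln (norm (v \<beta> i)) - ln (norm (v \<beta> j))))"
    proof (intro sum_mono mult_left_mono)
      have "ln (norm (v \<beta> i)) \<le> ln (U i)" if "i \<in> A" for i
      proof -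
        have "norm (v \<beta> i) > 0" using v_pos[OF that \<beta>] by auto
        moreover have "norm (v \<beta> i) \<le> norm p + norm (\<sigma> * of_real (d \<beta> i))"
          unfolding v_def by (rule norm_triangle_ineq)
        then have "norm (v \<beta> i) \<le> U i"
          using \<sigma> d_nonneg[OF that \<beta>(1)] by (simp add: norm_mult U_def)
        ultimately show ?thesis by (simp add: ln_mono)
      qed
      then show "\<beta> * \<kappa> i j + ln (EE \<beta>) - ln (U i) - ln (U j) \<le>
          \<beta> * \<kappa> i j + ln (EE \<beta>) - ln (norm (v \<beta> i)) - ln (norm (v \<beta> j))" if "i \<in> A" "j \<in> A" for i j
        using that by (simp add: diff_mono)
      show "0 \<le> r i * r j * \<kappa> i j * kk \<beta> i j" if "i \<in> A" "j \<in> A" for i j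
        using r \<kappa> that by (simp add: kk_def)
    qed
    finally show ?thesis .
  qed
  have "\<Phi> 0 \<le> \<Phi> \<alpha>"
    using \<alpha> by (rule DERIV_nonneg_imp_nondecreasing) (use deriv nonneg in blast)
  moreover have "\<Phi> 0 = 0"
  proof -
    have 0: "kk 0 i j = 1" "d 0 i = 0" "v 0 i = p" for i j
      by (simp_all add: kk_def d_def v_def)
    have "(\<Sum>i\<in>A. r i * \<Psi> 0 i) = S * Re (cnj \<sigma> * (p * Ln p))"
      by (simp add: \<Psi>_def 0 S_def sum_distrib_right)
    moreover have "Re ((cnj p - cnj \<sigma> * of_real S) * (p * Ln p)) = (norm p)\<^sup>2 * ln (norm p) - S * Re (cnj \<sigma> * (p * Ln p))"
    proof -
      have "(cnj p - cnj \<sigma> * of_real S) * (p * Ln p) = of_real ((norm p)\<^sup>2) * Ln p - of_real S * (cnj \<sigma> * (p * Ln p))"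
        by (simp add: algebra_simps complex_norm_square[unfolded of_real_power])
      then show ?thesis using pn by simp
    qed
    moreover have "ln ((norm p)\<^sup>2) = 2 * ln (norm p)" using pn by (simp add: ln_realpow)
    ultimately show ?thesis by (simp add: \<Phi>_def 0 EE_def)
  qed
  ultimately have "\<Phi> \<alpha> \<ge> 0" by simp
  moreover have "EE \<alpha> = E"
    by (simp add: EE_def E_def d_def k sum_distrib_left mult.assoc)
  moreover have "(\<Sum>i\<in>A. \<Sum>j\<in>A. r i * r j * (kk \<alpha> i j * (\<alpha> * \<kappa> i j))) = (\<Sum>i\<in>A. \<Sum>j\<in>A. r i * r j * (k i j * ln (k i j)))"
    by (intro sum.cong refl) (simp add: k, simp add: kk_def)
  moreover have "(\<Sum>i\<in>A. r i * \<Psi> \<alpha> i) = Re (\<Sum>i\<in>A. of_real (r i) * (cnj \<sigma> * (u i * Ln (u i))))"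
    by (simp add: \<Psi>_def u_eq)
  ultimately show ?thesis by (simp add: \<Phi>_def S_def)
qed

section \<open>The entropy inequality for nodes on one side of a distinguished node\<close>

text \<open>
  The automorphism \<open>y \<mapsto> (y - v) / (1 - v y)\<close> of the disc changes \<open>1 - y z\<close> by a product of a function
  of \<open>y\<close> and a function of \<open>z\<close>.
\<close>

lemma kernel_Moebius_gauge:
  fixes v y z :: real
  assumes "\<bar>v\<bar> < 1" "\<bar>y\<bar> < 1" "\<bar>z\<bar> < 1"
  shows "1 - y * z = (1 - v * y) * (1 - v * z) / (1 - v\<^sup>2) * (1 - (y - v) / (1 - v * y) * ((z - v) / (1 - v * z)))"
proof -
  have "v * y < 1" "v * z < 1" "v\<^sup>2 < 1"
    using abs_mult_less[OF assms(1,2)] abs_mult_less[OF assms(1,3)] assms(1)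
    by (auto simp: abs_mult[symmetric] abs_square_less_1)
  then have nz: "1 - v * y \<noteq> 0" "1 - v * z \<noteq> 0" "1 - v\<^sup>2 \<noteq> 0" by auto
  have "P * Q / R * (1 - a / P * (b / Q)) = (P * Q - a * b) / R" if "P \<noteq> 0" "Q \<noteq> 0" for P Q R a b :: real
  proof -
    have "P * Q * (1 - a / P * (b / Q)) = P * Q - a * b"
      using that by (simp add: right_diff_distrib)
    then show ?thesis by (metis times_divide_eq_left)
  qed
  from this[OF nz(1,2)]
  have "(1 - v * y) * (1 - v * z) / (1 - v\<^sup>2) * (1 - (y - v) / (1 - v * y) * ((z - v) / (1 - v * z)))
      = ((1 - v * y) * (1 - v * z) - (y - v) * (z - v)) / (1 - v\<^sup>2)" .
  also have "(1 - v * y) * (1 - v * z) - (y - v) * (z - v) = (1 - y * z) * (1 - v\<^sup>2)"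
    by (simp add: power2_eq_square algebra_simps)
  finally show ?thesis using nz(3) by simp
qed

text \<open>
  Both sides are unchanged when \<open>k\<^sub>i\<^sub>j\<close> is replaced by \<open>k\<^sub>i\<^sub>j / (a\<^sub>i a\<^sub>j)\<close> and \<open>c\<^sub>i\<close> by \<open>c\<^sub>i a\<^sub>i\<close> with \<open>a\<^sub>i > 0\<close>:
  the terms with \<open>ln a\<^sub>i\<close> that this creates are equal on the two sides (\<open>2 * Re G\<close> in the proof).  With the
  factors of \<open>kernel_Moebius_gauge\<close> this moves \<open>w s\<close> to \<open>0\<close>, and the remaining nodes, which lie on
  one side of \<open>w s\<close>, to points of equal sign.
\<close>

lemma kernel_entropy_inequality:
  fixes w r :: "'i \<Rightarrow> real" and c :: "'i \<Rightarrow> complex" and \<sigma> :: complex and \<alpha> :: real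
  assumes A: "finite A" "s \<in> A"
    and w: "\<And>i. i \<in> A \<Longrightarrow> \<bar>w i\<bar> < 1"
    and side: "\<And>i j. i \<in> A \<Longrightarrow> j \<in> A \<Longrightarrow> 0 \<le> (w i - w s) * (w j - w s)"
    and r: "\<And>i. i \<in> A \<Longrightarrow> 0 \<le> r i" and \<sigma>: "norm \<sigma> = 1"
    and c: "\<And>i. i \<in> A - {s} \<Longrightarrow> c i = \<sigma> * of_real (r i)"
    and \<alpha>: "\<alpha> \<ge> 0"
  defines "k \<equiv> \<lambda>i j. (1 - w i * w j) powr (- \<alpha>)"
  defines "u \<equiv> \<lambda>i. \<Sum>j\<in>A. c j * of_real (k i j)"
  defines "E \<equiv> Re (\<Sum>i\<in>A. cnj (c i) * u i)"
  assumes u: "\<And>i. i \<in> A \<Longrightarrow> Re (u i) > 0"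
  shows "2 * Re (\<Sum>i\<in>A. cnj (c i) * (u i * Ln (u i)))
     \<le> Re (\<Sum>i\<in>A. \<Sum>j\<in>A. cnj (c i) * c j * of_real (k i j * ln (k i j))) + E * ln E"
proof -
  define B where "B = A - {s}"
  define x where "x i = (w i - w s) / (1 - w s * w i)" for i
  define a where "a i = (sqrt (1 - (w s)\<^sup>2) / (1 - w s * w i)) powr \<alpha>" for i
  define k' where "k' i j = (1 - x i * x j) powr (- \<alpha>)" for i j
  define c' where "c' i = c i * of_real (a i)" for i
  define r' where "r' i = r i * a i" for i
  define u' where "u' i = (\<Sum>j\<in>A. c' j * of_real (k' i j))" for i
  define p where "p = u' s"
  define S where "S = (\<Sum>i\<in>B. r' i)"
  define d where "d i = (\<Sum>j\<in>B. r' j * (k' i j - 1))" for i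
  have sumA: "sum g A = g s + sum g B" for g :: "'i \<Rightarrow> complex"
    unfolding B_def by (rule sum.remove[OF A])
  have BA: "i \<in> A" if "i \<in> B" for i using that by (simp add: B_def)
  have ws: "w s * w i < 1" if "i \<in> A" for i
    using abs_mult_less[OF w[OF A(2)] w[OF that]] by (simp add: abs_mult[symmetric])
  have ws2: "1 - (w s)\<^sup>2 > 0" using ws[OF A(2)] by (simp add: power2_eq_square)
  have a: "a i > 0" if "i \<in> A" for i
    unfolding a_def using ws[OF that] ws2 by simp
  have x1: "\<bar>x i\<bar> < 1" if "i \<in> A" for i
  proof -
    have "(1 - w s * w i)\<^sup>2 - (w i - w s)\<^sup>2 = (1 - (w i)\<^sup>2) * (1 - (w s)\<^sup>2)"
      by (simp add: power2_eq_square algebra_simps)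
    also have "\<dots> > 0" using ws2 w[OF that] by (simp add: abs_square_less_1)
    finally have "\<bar>w i - w s\<bar> < \<bar>1 - w s * w i\<bar>" using abs_le_square_iff[of "1 - w s * w i" "w i - w s"] by linarith
    then show ?thesis using ws[OF that] by (simp add: x_def abs_divide)
  qed
  have xx: "x i * x j < 1" if "i \<in> A" "j \<in> A" for i j
    using abs_mult_less[OF x1[OF that(1)] x1[OF that(2)]] by (simp add: abs_mult[symmetric])
  have same: "0 \<le> x i * x j" if "i \<in> A" "j \<in> A" for i j
    using side[OF that] ws[OF that(1)] ws[OF that(2)] by (simp add: x_def)
  have xs: "x s = 0" by (simp add: x_def)
  have k's: "k' s j = 1" "k' j s = 1" for j by (simp_all add: k'_def xs)
  have k'pos: "k' i j > 0" if "i \<in> A" "j \<in> A" for i j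
    unfolding k'_def using xx[OF that] by simp
  have k: "k i j = a i * a j * k' i j" if "i \<in> A" "j \<in> A" for i j
  proof -
    have "k i j = ((1 - w s * w i) * (1 - w s * w j) / (1 - (w s)\<^sup>2) * (1 - x i * x j)) powr (- \<alpha>)"
      unfolding k_def x_def using kernel_Moebius_gauge[OF w[OF A(2)] w[OF that(1)] w[OF that(2)]] by simp
    also have "\<dots> = ((1 - w s * w i) * (1 - w s * w j) / (1 - (w s)\<^sup>2)) powr (- \<alpha>) * k' i j"
      unfolding k'_def using ws that ws2 xx[OF that] by (subst powr_mult) auto
    also have "((1 - w s * w i) * (1 - w s * w j) / (1 - (w s)\<^sup>2)) powr (- \<alpha>)
        = (sqrt (1 - (w s)\<^sup>2) / (1 - w s * w i) * (sqrt (1 - (w s)\<^sup>2) / (1 - w s * w j))) powr \<alpha>"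
    proof -
      define q where "q = (1 - w s * w i) * (1 - w s * w j) / (1 - (w s)\<^sup>2)"
      have q: "q > 0" unfolding q_def using ws that ws2 by simp
      have "sqrt (1 - (w s)\<^sup>2) * sqrt (1 - (w s)\<^sup>2) = 1 - (w s)\<^sup>2" using ws2 by simp
      then have "sqrt (1 - (w s)\<^sup>2) / (1 - w s * w i) * (sqrt (1 - (w s)\<^sup>2) / (1 - w s * w j))
          = 1 / q"
        by (simp only: q_def times_divide_times_eq) simp
      then show ?thesis
        unfolding q_def[symmetric] using q by (simp add: powr_minus_divide powr_divide)
    qed
    also have "\<dots> = a i * a j"
      unfolding a_def using ws that ws2 by (subst powr_mult) auto
    finally show ?thesis .
  qed
  have uu': "u i = of_real (a i) * u' i" if "i \<in> A" for i
    unfolding u_def u'_def c'_def sum_distrib_left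
    by (intro sum.cong refl) (simp add: k that mult_ac)
  have c'B: "c' i = \<sigma> * of_real (r' i)" if "i \<in> B" for i
    using c that by (simp add: c'_def r'_def B_def)
  have p_eq: "p = c' s + \<sigma> * of_real S"
    unfolding p_def u'_def sumA by (simp add: k's c'B S_def sum_distrib_left)
  have u'_eq: "u' i = p + \<sigma> * of_real (d i)" for i
    unfolding p_eq u'_def sumA
    by (simp add: k's c'B S_def d_def sum_distrib_left algebra_simps flip: sum.distrib of_real_add)
  have u'pos: "Re (u' i) > 0" if "i \<in> A" for i
    using u[OF that] a[OF that] unfolding uu'[OF that] by (simp add: zero_less_mult_iff)
  have \<sigma>\<sigma>: "cnj \<sigma> * \<sigma> = 1" using \<sigma> by (simp add: complex_norm_square[symmetric] mult.commute)
  define E' where "E' = (norm p)\<^sup>2 + (\<Sum>i\<in>B. r' i * d i)"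
  have main: "2 * Re ((cnj p - cnj \<sigma> * of_real S) * (p * Ln p)
           + (\<Sum>i\<in>B. of_real (r' i) * (cnj \<sigma> * (u' i * Ln (u' i)))))
      \<le> (\<Sum>i\<in>B. \<Sum>j\<in>B. r' i * r' j * (k' i j * ln (k' i j))) + E' * ln E'"
  proof -
    have E'_eq: "E' = (norm p)\<^sup>2 + (\<Sum>i\<in>B. \<Sum>j\<in>B. r' i * r' j * (k' i j - 1))"
      by (simp add: E'_def d_def sum_distrib_left mult.assoc)
    show ?thesis
      unfolding E'_eq u'_eq d_def S_def k'_def
    proof (rule normalized_entropy_inequality)
      show "0 \<le> r' i" if "i \<in> B" for i using r a BA[OF that] by (simp add: r'_def less_imp_le)
      show "0 < Re p" unfolding p_def by (rule u'pos[OF A(2)])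
      show "0 < Re (p + \<sigma> * of_real (\<Sum>j\<in>B. r' j * ((1 - x i * x j) powr - \<alpha> - 1)))" if "i \<in> B" for i
        using u'pos[OF BA[OF that]] unfolding u'_eq d_def k'_def .
    qed (use x1 same BA \<sigma> \<alpha> in auto)
  qed
  have c's: "cnj (c' s) = cnj p - cnj \<sigma> * of_real S" by (simp add: p_eq)
  have cc: "cnj (c i) * (u i * z) = cnj (c' i) * (u' i * z)" if "i \<in> A" for i z
    using uu'[OF that] by (simp add: c'_def)
  have EE': "E = E'"
  proof -
    have "(\<Sum>i\<in>A. cnj (c i) * u i) = (\<Sum>i\<in>A. cnj (c' i) * u' i)"
      using cc[where z = 1] by simp
    also have "\<dots> = (cnj p - cnj \<sigma> * of_real S) * p + (\<Sum>i\<in>B. of_real (r' i) * (cnj \<sigma> * u' i))"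
      unfolding sumA c's p_def[symmetric] by (simp add: c'B mult_ac)
    also have "(\<Sum>i\<in>B. of_real (r' i) * (cnj \<sigma> * u' i)) = (\<Sum>i\<in>B. of_real (r' i) * (cnj \<sigma> * p) + of_real (r' i * d i))"
      by (intro sum.cong refl) (use \<sigma>\<sigma> in \<open>simp add: u'_eq distrib_left mult.assoc[symmetric]\<close>)
    also have "\<dots> = of_real S * (cnj \<sigma> * p) + of_real (\<Sum>i\<in>B. r' i * d i)"
      by (simp add: S_def sum.distrib sum_distrib_right)
    finally have "(\<Sum>i\<in>A. cnj (c i) * u i) = cnj p * p + of_real (\<Sum>i\<in>B. r' i * d i)"
      by (simp add: algebra_simps)
    then show ?thesis by (simp add: E_def E'_def complex_mult_cnj cmod_power2 mult.commute[of "cnj p"])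
  qed
  define G where "G = (\<Sum>i\<in>A. cnj (c' i) * (u' i * of_real (ln (a i))))"
  have left: "(\<Sum>i\<in>A. cnj (c i) * (u i * Ln (u i)))
      = (cnj p - cnj \<sigma> * of_real S) * (p * Ln p) + (\<Sum>i\<in>B. of_real (r' i) * (cnj \<sigma> * (u' i * Ln (u' i)))) + G"
  proof -
    have "cnj (c i) * (u i * Ln (u i)) = cnj (c' i) * (u' i * Ln (u' i)) + cnj (c' i) * (u' i * of_real (ln (a i)))"
      if "i \<in> A" for i
    proof -
      have "u' i \<noteq> 0" using u'pos[OF that] by auto
      then have "Ln (u i) = of_real (ln (a i)) + Ln (u' i)"
        unfolding uu'[OF that] using a[OF that] by (simp add: Ln_times_of_real Ln_of_real)
      then show ?thesis unfolding cc[OF that] by (simp add: algebra_simps)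
    qed
    then have "(\<Sum>i\<in>A. cnj (c i) * (u i * Ln (u i))) = (\<Sum>i\<in>A. cnj (c' i) * (u' i * Ln (u' i))) + G"
      by (simp add: G_def sum.distrib)
    also have "(\<Sum>i\<in>A. cnj (c' i) * (u' i * Ln (u' i)))
      = (cnj p - cnj \<sigma> * of_real S) * (p * Ln p) + (\<Sum>i\<in>B. of_real (r' i) * (cnj \<sigma> * (u' i * Ln (u' i))))"
      unfolding sumA c's p_def[symmetric] by (simp add: c'B mult_ac)
    finally show ?thesis .
  qed
  have right: "Re (\<Sum>i\<in>A. \<Sum>j\<in>A. cnj (c i) * c j * of_real (k i j * ln (k i j)))
      = (\<Sum>i\<in>B. \<Sum>j\<in>B. r' i * r' j * (k' i j * ln (k' i j))) + 2 * Re G"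
  proof -
    have sym: "k' i j = k' j i" for i j by (simp add: k'_def mult.commute)
    let ?t = "\<lambda>i j. cnj (c' i) * c' j * of_real (k' i j)"
    have "cnj (c i) * c j * of_real (k i j * ln (k i j))
        = ?t i j * of_real (ln (k' i j)) + ?t i j * of_real (ln (a i)) + cnj (?t j i * of_real (ln (a j)))"
      if "i \<in> A" "j \<in> A" for i j
    proof -
      have "ln (k i j) = ln (k' i j) + ln (a i) + ln (a j)"
        unfolding k[OF that] using a[OF that(1)] a[OF that(2)] k'pos[OF that] by (simp add: ln_mult)
      then show ?thesis
        unfolding k[OF that] by (simp add: c'_def sym[of j i] algebra_simps)
    qed
    then have "(\<Sum>i\<in>A. \<Sum>j\<in>A. cnj (c i) * c j * of_real (k i j * ln (k i j)))
        = (\<Sum>i\<in>A. \<Sum>j\<in>A. ?t i j * of_real (ln (k' i j))) + (\<Sum>i\<in>A. \<Sum>j\<in>A. ?t i j * of_real (ln (a i)))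
          + (\<Sum>i\<in>A. \<Sum>j\<in>A. cnj (?t j i * of_real (ln (a j))))"
      by (simp add: sum.distrib)
    also have "(\<Sum>i\<in>A. \<Sum>j\<in>A. cnj (?t j i * of_real (ln (a j)))) = cnj (\<Sum>i\<in>A. \<Sum>j\<in>A. ?t i j * of_real (ln (a i)))"
      by (subst sum.swap) (simp add: cnj_sum)
    also have "(\<Sum>i\<in>A. \<Sum>j\<in>A. ?t i j * of_real (ln (a i))) = G"
      unfolding G_def u'_def by (simp add: sum_distrib_left sum_distrib_right mult_ac)
    also have "(\<Sum>i\<in>A. \<Sum>j\<in>A. ?t i j * of_real (ln (k' i j))) = of_real (\<Sum>i\<in>B. \<Sum>j\<in>B. r' i * r' j * (k' i j * ln (k' i j)))"
    proof -
      have t: "?t i j = of_real (r' i * r' j * k' i j)" if "i \<in> B" "j \<in> B" for i j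
        using that \<sigma>\<sigma> by (simp add: c'B)
      have "(\<Sum>i\<in>A. \<Sum>j\<in>A. ?t i j * of_real (ln (k' i j))) = (\<Sum>i\<in>B. \<Sum>j\<in>B. ?t i j * of_real (ln (k' i j)))"
        by (simp add: sumA k's)
      also have "\<dots> = (\<Sum>i\<in>B. \<Sum>j\<in>B. of_real (r' i * r' j * k' i j) * of_real (ln (k' i j)))"
        by (intro sum.cong refl) (simp only: t)
      finally show ?thesis by (simp add: mult.assoc)
    qed
    finally show ?thesis by simp
  qed
  show ?thesis unfolding left right EE' using main by simp
qed

section \<open>Rotation invariance and radial part of Lebesgue measure on the disc\<close>

lemma measurable_Complex [measurable]: "(\<lambda>(x, y). Complex x y) \<in> borel_measurable (lborel \<Otimes>\<^sub>M lborel)"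
  by (simp add: Complex_eq case_prod_unfold)

text \<open>
  Integrals over the plane become iterated integrals, which makes shears accessible to Fubini.
\<close>

lemma lborel_complex_eq_distr:
  "(lborel :: complex measure) = distr (lborel \<Otimes>\<^sub>M lborel) borel (\<lambda>(x, y). Complex x y)"
proof (rule lborel_eqI)
  fix l u :: complex
  assume le: "\<And>b. b \<in> Basis \<Longrightarrow> l \<bullet> b \<le> u \<bullet> b"
  have le': "Re l \<le> Re u" "Im l \<le> Im u"
    using le[of 1] le[of \<i>] by (auto simp: Basis_complex_def)
  have "emeasure (distr (lborel \<Otimes>\<^sub>M lborel) borel (\<lambda>(x, y). Complex x y)) (box l u)
      = emeasure (lborel \<Otimes>\<^sub>M lborel) ({Re l<..<Re u} \<times> {Im l<..<Im u})"
    by (subst emeasure_distr)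
      (auto simp: box_def Basis_complex_def space_pair_measure intro!: arg_cong2[where f = emeasure])
  also have "\<dots> = ennreal (Re u - Re l) * ennreal (Im u - Im l)"
    using le' by (simp add: lborel.emeasure_pair_measure_Times)
  also have "\<dots> = ennreal (\<Prod>b\<in>Basis. (u - l) \<bullet> b)"
    using le' by (simp add: Basis_complex_def ennreal_mult)
  finally show "emeasure (distr (lborel \<Otimes>\<^sub>M lborel) borel (\<lambda>(x, y). Complex x y)) (box l u)
      = ennreal (\<Prod>b\<in>Basis. (u - l) \<bullet> b)" .
qed simp

lemma nn_integral_lborel_complex:
  assumes [measurable]: "F \<in> borel_measurable borel"
  shows "(\<integral>\<^sup>+z. F z \<partial>lborel) = (\<integral>\<^sup>+y. \<integral>\<^sup>+x. F (Complex x y) \<partial>lborel \<partial>lborel)"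
    and "(\<integral>\<^sup>+z. F z \<partial>lborel) = (\<integral>\<^sup>+x. \<integral>\<^sup>+y. F (Complex x y) \<partial>lborel \<partial>lborel)"
proof -
  have eq: "(\<integral>\<^sup>+z. F z \<partial>lborel) = (\<integral>\<^sup>+p. F (case p of (x, y) \<Rightarrow> Complex x y) \<partial>(lborel \<Otimes>\<^sub>M lborel))"
    by (subst lborel_complex_eq_distr) (simp add: nn_integral_distr)
  show "(\<integral>\<^sup>+z. F z \<partial>lborel) = (\<integral>\<^sup>+x. \<integral>\<^sup>+y. F (Complex x y) \<partial>lborel \<partial>lborel)"
    unfolding eq by (subst lborel.nn_integral_fst[symmetric]) auto
  show "(\<integral>\<^sup>+z. F z \<partial>lborel) = (\<integral>\<^sup>+y. \<integral>\<^sup>+x. F (Complex x y) \<partial>lborel \<partial>lborel)"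
    unfolding eq by (subst lborel_pair.nn_integral_snd[symmetric]) auto
qed

lemma nn_integral_shift:
  fixes F :: "real \<Rightarrow> ennreal"
  assumes "F \<in> borel_measurable borel"
  shows "(\<integral>\<^sup>+x. F (a + x) \<partial>lborel) = (\<integral>\<^sup>+x. F x \<partial>lborel)"
  using nn_integral_real_affine[OF assms, of 1 a] by simp

lemma nn_integral_shear:
  fixes F :: "complex \<Rightarrow> ennreal"
  assumes [measurable]: "F \<in> borel_measurable borel"
  shows "(\<integral>\<^sup>+z. F (Complex (Re z + t * Im z) (Im z)) \<partial>lborel) = (\<integral>\<^sup>+z. F z \<partial>lborel)"
    and "(\<integral>\<^sup>+z. F (Complex (Re z) (Im z + t * Re z)) \<partial>lborel) = (\<integral>\<^sup>+z. F z \<partial>lborel)"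
proof -
  have m: "(\<lambda>x. F (Complex x y)) \<in> borel_measurable borel" "(\<lambda>x. F (Complex y x)) \<in> borel_measurable borel" for y
    by (simp_all add: Complex_eq)
  have [measurable]: "(\<lambda>z. F (Complex (Re z + t * Im z) (Im z))) \<in> borel_measurable borel"
    "(\<lambda>z. F (Complex (Re z) (Im z + t * Re z))) \<in> borel_measurable borel"
    by (simp_all add: Complex_eq)
  show "(\<integral>\<^sup>+z. F (Complex (Re z + t * Im z) (Im z)) \<partial>lborel) = (\<integral>\<^sup>+z. F z \<partial>lborel)"
  proof -
    have "(\<integral>\<^sup>+x. F (Complex (t * y + x) y) \<partial>lborel) = (\<integral>\<^sup>+x. F (Complex x y) \<partial>lborel)" for y
      by (rule nn_integral_shift[OF m(1)])
    then show ?thesis by (simp add: nn_integral_lborel_complex(1) add.commute)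
  qed
  show "(\<integral>\<^sup>+z. F (Complex (Re z) (Im z + t * Re z)) \<partial>lborel) = (\<integral>\<^sup>+z. F z \<partial>lborel)"
  proof -
    have "(\<integral>\<^sup>+y. F (Complex x (t * x + y)) \<partial>lborel) = (\<integral>\<^sup>+y. F (Complex x y) \<partial>lborel)" for x
      by (rule nn_integral_shift[OF m(2)])
    then show ?thesis by (simp add: nn_integral_lborel_complex(2) add.commute)
  qed
qed

text \<open>
  A rotation is a product of three shears, each of which preserves area.  The factor
  \<open>t = - tan (\<theta> / 2)\<close> of the horizontal shears does not exist for the half-turn.
\<close>

lemma lborel_distr_rotation:
  fixes \<omega> :: complex
  assumes \<omega>: "norm \<omega> = 1" "Re \<omega> \<noteq> -1"
  shows "distr lborel borel (\<lambda>z. \<omega> * z) = lborel"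
proof -
  define s where "s = Im \<omega>"
  define t where "t = - s / (1 + Re \<omega>)"
  have nz: "1 + Re \<omega> \<noteq> 0" using \<omega>(2) by auto
  have "(Re \<omega>)\<^sup>2 + s\<^sup>2 = 1" using \<omega>(1) by (simp add: s_def cmod_def)
  then have "s\<^sup>2 = (1 - Re \<omega>) * (1 + Re \<omega>)" by (simp add: power2_eq_square algebra_simps)
  then have st: "s * t = Re \<omega> - 1" using nz by (simp add: t_def power2_eq_square field_simps)
  have "t * (1 + Re \<omega>) = - s" using nz by (simp add: t_def)
  then have tt: "t * Re \<omega> + t = - s" by (simp add: algebra_simps)
  define X where "X z = Complex (Re z + t * Im z) (Im z)" for z
  define Y where "Y z = Complex (Re z) (Im z + s * Re z)" for z
  have [measurable]: "X \<in> borel_measurable borel" "Y \<in> borel_measurable borel"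
    unfolding X_def Y_def by (simp_all add: Complex_eq)
  have rot: "\<omega> * z = X (Y (X z))" for z
  proof (rule complex_eqI)
    have "Im (X (Y (X z))) = (1 + s * t) * Im z + s * Re z"
      by (simp add: X_def Y_def algebra_simps)
    then show "Im (\<omega> * z) = Im (X (Y (X z)))" using st by (simp add: s_def)
    have "Re (X (Y (X z))) = (1 + s * t) * Re z + (t + t * (1 + s * t)) * Im z"
      by (simp add: X_def Y_def algebra_simps)
    also have "t + t * (1 + s * t) = - s" using tt by (simp add: st algebra_simps)
    finally show "Re (\<omega> * z) = Re (X (Y (X z)))" using st by (simp add: s_def)
  qed
  have "(\<integral>\<^sup>+z. F (\<omega> * z) \<partial>lborel) = (\<integral>\<^sup>+z. F z \<partial>lborel)" if [measurable]: "F \<in> borel_measurable borel" for F :: "complex \<Rightarrow> ennreal"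
  proof -
    have "(\<integral>\<^sup>+z. F (\<omega> * z) \<partial>lborel) = (\<integral>\<^sup>+z. F (X (Y z)) \<partial>lborel)"
      unfolding rot using nn_integral_shear(1)[of "\<lambda>z. F (X (Y z))" t] by (simp add: X_def[symmetric])
    also have "\<dots> = (\<integral>\<^sup>+z. F (X z) \<partial>lborel)"
      using nn_integral_shear(2)[of "\<lambda>z. F (X z)" s] by (simp add: Y_def[symmetric])
    also have "\<dots> = (\<integral>\<^sup>+z. F z \<partial>lborel)"
      using nn_integral_shear(1)[of F t] by (simp add: X_def[symmetric])
    finally show ?thesis .
  qed
  note rot_int = this
  show ?thesis
  proof (rule measure_eqI)
    fix A :: "complex set" assume "A \<in> sets (distr lborel borel (\<lambda>z. \<omega> * z))"
    then have [measurable]: "A \<in> sets borel" by simp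
    have "emeasure (distr lborel borel (\<lambda>z. \<omega> * z)) A = (\<integral>\<^sup>+z. indicator A z \<partial>distr lborel borel (\<lambda>z. \<omega> * z))"
      by simp
    also have "\<dots> = (\<integral>\<^sup>+z. indicator A (\<omega> * z) \<partial>lborel)"
      by (rule nn_integral_distr) auto
    also have "\<dots> = emeasure lborel A"
      by (subst rot_int) auto
    finally show "emeasure (distr lborel borel (\<lambda>z. \<omega> * z)) A = emeasure lborel A" .
  qed simp
qed

text \<open>
  The disc of radius \<open>sqrt t\<close> has area \<open>\<pi> t\<close>, so \<open>|z|\<^sup>2\<close> is uniformly distributed.
\<close>

lemma distr_norm_square_disc:
  "distr (restrict_space lborel (ball 0 1)) borel (\<lambda>z::complex. (norm z)\<^sup>2)
    = density lborel (\<lambda>t. ennreal pi * indicator {0<..<1} t)"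
proof (rule measure_eqI_lessThan)
  fix x :: real
  define r where "r = sqrt (max 0 x)"
  have r: "r \<ge> 0" "r\<^sup>2 = max 0 x" by (simp_all add: r_def)
  have "emeasure (distr (restrict_space lborel (ball 0 1)) borel (\<lambda>z::complex. (norm z)\<^sup>2)) {x<..}
      = emeasure (restrict_space lborel (ball 0 1)) {z \<in> ball (0::complex) 1. x < (norm z)\<^sup>2}"
    by (subst emeasure_distr)
      (auto intro!: arg_cong2[where f = emeasure] measurable_restrict_space1 simp: space_restrict_space)
  also have "\<dots> = emeasure lborel {z \<in> ball (0::complex) 1. x < (norm z)\<^sup>2}"
    by (rule emeasure_restrict_space) auto
  also have "\<dots> = ennreal (pi * (1 - min 1 (max 0 x)))"
  proof (cases "x < 0")
    case True
    then have "{z \<in> ball (0::complex) 1. x < (norm z)\<^sup>2} = ball 0 1"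
      by (auto intro: less_le_trans)
    then show ?thesis using True by (simp add: emeasure_ball unit_ball_vol_2)
  next
    case False
    show ?thesis
    proof (cases "x < 1")
      case True
      have "{z \<in> ball (0::complex) 1. x < (norm z)\<^sup>2} = ball 0 1 - cball 0 (sqrt x)"
        using False by (auto simp: real_sqrt_less_iff not_le real_less_lsqrt intro: real_less_rsqrt)
          (metis norm_ge_zero not_le real_le_rsqrt real_sqrt_le_iff real_sqrt_abs abs_norm_cancel)+
      also have "emeasure lborel \<dots> = emeasure lborel (ball (0::complex) 1) - emeasure lborel (cball (0::complex) (sqrt x))"
      proof (rule emeasure_Diff)
        have "sqrt x < 1" using True by simp
        then show "cball (0::complex) (sqrt x) \<subseteq> ball 0 1"
          by (auto simp del: real_sqrt_lt_1_iff)
      qed (use False in \<open>auto simp: emeasure_cball\<close>)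
      also have "\<dots> = ennreal (pi * (1 - min 1 (max 0 x)))"
        using True False by (simp add: emeasure_cball emeasure_ball unit_ball_vol_2 ennreal_minus right_diff_distrib)
      finally show ?thesis .
    next
      case F: False
      then have *: "{z \<in> ball (0::complex) 1. x < (norm z)\<^sup>2} = {}"
        by (auto simp: not_less abs_square_less_1) (smt (verit) norm_ge_zero power_le_one)
      show ?thesis unfolding * using F by simp
    qed
  qed
  finally have L: "emeasure (distr (restrict_space lborel (ball 0 1)) borel (\<lambda>z::complex. (norm z)\<^sup>2)) {x<..}
      = ennreal (pi * (1 - min 1 (max 0 x)))" .
  show "emeasure (distr (restrict_space lborel (ball 0 1)) borel (\<lambda>z::complex. (norm z)\<^sup>2)) {x<..} < \<infinity>"
    unfolding L by simp
  have "emeasure (density lborel (\<lambda>t. ennreal pi * indicator {0<..<1} t)) {x<..}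
      = (\<integral>\<^sup>+t. ennreal pi * indicator {max 0 x<..<max 1 x} t \<partial>lborel)" if "x < 1"
    by (subst emeasure_density)
      (auto intro!: nn_integral_cong simp: that split: split_indicator)
  then have "emeasure (density lborel (\<lambda>t. ennreal pi * indicator {0<..<1} t)) {x<..}
      = ennreal (pi * (1 - min 1 (max 0 x)))" if "x < 1"
    using that by (simp add: nn_integral_cmult ennreal_mult')
  moreover have "emeasure (density lborel (\<lambda>t. ennreal pi * indicator {0<..<1} t)) {x<..} = 0" if "x \<ge> 1"
  proof (subst emeasure_density)
    have "(\<integral>\<^sup>+t. ennreal pi * indicator {0<..<1} t * indicator {x<..} t \<partial>lborel) = (\<integral>\<^sup>+t. 0 \<partial>(lborel :: real measure))"
      by (rule nn_integral_cong) (use that in \<open>auto split: split_indicator\<close>)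
    then show "(\<integral>\<^sup>+t. ennreal pi * indicator {0<..<1} t * indicator {x<..} t \<partial>lborel) = 0" by simp
  qed auto
  ultimately show "emeasure (distr (restrict_space lborel (ball 0 1)) borel (\<lambda>z::complex. (norm z)\<^sup>2)) {x<..}
      = emeasure (density lborel (\<lambda>t. ennreal pi * indicator {0<..<1} t)) {x<..}"
    unfolding L by (cases "x < 1") auto
qed simp_all

section \<open>The weighted Bergman measures and their moments\<close>

definition bergman_measure :: "real \<Rightarrow> complex measure" where
  "bergman_measure \<beta> = density (restrict_space lborel (ball 0 1))
     (\<lambda>z. ennreal ((\<beta> - 1) * (1 - (norm z)\<^sup>2) powr (\<beta> - 2) / pi))"

lemma space_bergman [simp]: "space (bergman_measure \<beta>) = ball 0 1"
  by (simp add: bergman_measure_def space_restrict_space)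

lemma sets_bergman [measurable_cong]: "sets (bergman_measure \<beta>) = sets (restrict_space borel (ball 0 1))"
  by (simp add: bergman_measure_def) (simp add: sets_restrict_space)

lemma bergman_density_measurable [measurable]:
  "(\<lambda>z. (\<beta> - 1) * (1 - (norm z)\<^sup>2) powr (\<beta> - 2) / pi) \<in> borel_measurable (restrict_space lborel (ball (0::complex) 1))"
  by (rule measurable_restrict_space1) measurable

text \<open>
  In the variable \<open>t = |z|\<^sup>2\<close> this is the Beta integral.
\<close>

lemma nn_integral_bergman_power:
  assumes \<beta>: "\<beta> > 1"
  shows "(\<integral>\<^sup>+z. ennreal ((norm z) ^ (2 * n)) \<partial>bergman_measure \<beta>) = ennreal (fact n / pochhammer \<beta> n)"
proof -
  let ?D = "restrict_space lborel (ball (0::complex) 1)"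
  define \<phi> where "\<phi> t = (\<beta> - 1) * (1 - t) powr (\<beta> - 2) / pi * t ^ n" for t :: real
  have [measurable]: "\<phi> \<in> borel_measurable borel" unfolding \<phi>_def by measurable
  have "(\<integral>\<^sup>+z. ennreal ((norm z) ^ (2 * n)) \<partial>bergman_measure \<beta>) = (\<integral>\<^sup>+z. ennreal (\<phi> ((norm z)\<^sup>2)) \<partial>?D)"
    unfolding bergman_measure_def
    by (subst nn_integral_density)
      (use \<beta> in \<open>auto intro!: nn_integral_cong measurable_restrict_space1 simp: \<phi>_def ennreal_mult[symmetric] power_mult\<close>)
  also have "\<dots> = (\<integral>\<^sup>+t. ennreal (\<phi> t) \<partial>distr ?D borel (\<lambda>z. (norm z)\<^sup>2))"
    by (subst nn_integral_distr) (auto intro!: measurable_restrict_space1)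
  also have "\<dots> = (\<integral>\<^sup>+t. ennreal ((\<beta> - 1) * (t powr (real (Suc n) - 1) * (1 - t) powr (\<beta> - 1 - 1))) * indicator {0<..<1} t \<partial>lborel)"
    unfolding distr_norm_square_disc
    by (subst nn_integral_density)
      (auto intro!: nn_integral_cong simp: \<phi>_def powr_realpow ennreal_mult'[symmetric] mult_ac split: split_indicator)
  also have "\<dots> = ennreal ((\<beta> - 1) * Beta (real (Suc n)) (\<beta> - 1))"
  proof (rule nn_integral_has_integral_lebesgue')
    have "((\<lambda>t. t powr (real (Suc n) - 1) * (1 - t) powr (\<beta> - 1 - 1)) has_integral Beta (real (Suc n)) (\<beta> - 1)) {0<..<1}"
      using has_integral_Beta_real[of "real (Suc n)" "\<beta> - 1"] \<beta> by (simp add: has_integral_Icc_iff_Ioo)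
    then show "((\<lambda>t. (\<beta> - 1) * (t powr (real (Suc n) - 1) * (1 - t) powr (\<beta> - 1 - 1))) has_integral (\<beta> - 1) * Beta (real (Suc n)) (\<beta> - 1)) {0<..<1}"
      by (rule has_integral_mult_right)
  qed (use \<beta> in auto)
  also have "(\<beta> - 1) * Beta (real (Suc n)) (\<beta> - 1) = fact n / pochhammer \<beta> n"
  proof -
    have "\<beta> \<notin> \<int>\<^sub>\<le>\<^sub>0" "\<beta> - 1 \<notin> \<int>\<^sub>\<le>\<^sub>0" using \<beta> by (auto elim!: nonpos_Ints_cases)
    then have "(\<beta> - 1) * Gamma (\<beta> - 1) = Gamma \<beta>" "pochhammer \<beta> n = Gamma (\<beta> + n) / Gamma \<beta>"
      using Gamma_plus1[of "\<beta> - 1"] pochhammer_Gamma[of \<beta> n] by simp_all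
    moreover have "Gamma (real (Suc n)) = fact n" using Gamma_fact[of n, where 'a = real] by (simp add: add.commute)
    ultimately show ?thesis
      by (simp add: Beta_def add_ac)
  qed
  finally show ?thesis .
qed

lemma finite_measure_bergman:
  assumes "\<beta> > 1" shows "finite_measure (bergman_measure \<beta>)"
  using nn_integral_bergman_power[OF assms, of 0] by (intro finite_measureI) simp

section \<open>The reproducing property\<close>

lemma bergman_measurable_continuous:
  fixes g :: "complex \<Rightarrow> 'b::topological_space"
  assumes "continuous_on (ball 0 1) g"
  shows "g \<in> borel_measurable (bergman_measure \<beta>)"
proof -
  have "g \<in> borel_measurable (restrict_space borel (ball 0 1))"
    by (rule borel_measurable_continuous_on_restrict[OF assms])
  then show ?thesis by (simp cong: measurable_cong_sets add: sets_bergman measurable_cong_sets[OF sets_bergman refl])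
qed

lemma bergman_integrable_bounded:
  fixes g :: "complex \<Rightarrow> 'b::{banach, second_countable_topology}"
  assumes \<beta>: "\<beta> > 1" and g: "continuous_on (ball 0 1) g"
    and C: "\<And>z. z \<in> ball 0 1 \<Longrightarrow> norm (g z) \<le> C"
  shows "integrable (bergman_measure \<beta>) g"
proof -
  interpret finite_measure "bergman_measure \<beta>" by (rule finite_measure_bergman[OF \<beta>])
  show ?thesis
    by (rule integrable_const_bound[where B = C])
      (use C in \<open>auto intro!: bergman_measurable_continuous g AE_I2\<close>)
qed

lemma (in finite_measure) integral_sums_dominated:
  fixes f :: "nat \<Rightarrow> 'a \<Rightarrow> 'b::{banach, second_countable_topology}"
  assumes int: "\<And>n. integrable M (f n)"
    and le: "\<And>n x. x \<in> space M \<Longrightarrow> norm (f n x) \<le> b n" and b: "summable b"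
    and s: "\<And>x. x \<in> space M \<Longrightarrow> (\<lambda>n. f n x) sums s x"
  shows "(\<lambda>n. integral\<^sup>L M (f n)) sums integral\<^sup>L M s"
proof -
  have 1: "summable (\<lambda>n. norm (f n x))" if "x \<in> space M" for x
    by (rule summable_comparison_test'[OF b, of 0]) (use le that in auto)
  have 2: "summable (\<lambda>n. \<integral>x. norm (f n x) \<partial>M)"
  proof (rule summable_comparison_test'[OF summable_mult2[OF b], of 0])
    fix n
    have "(\<integral>x. norm (f n x) \<partial>M) \<le> (\<integral>x. b n \<partial>M)"
      by (rule integral_mono) (use int le in auto)
    then show "norm (\<integral>x. norm (f n x) \<partial>M) \<le> b n * measure M (space M)"
      by (simp add: mult.commute)
  qed
  have "(\<lambda>n. integral\<^sup>L M (f n)) sums (\<integral>x. (\<Sum>n. f n x) \<partial>M)"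
    by (rule sums_integral) (use int 1 2 in \<open>auto intro!: AE_I2\<close>)
  also have "(\<integral>x. (\<Sum>n. f n x) \<partial>M) = integral\<^sup>L M s"
    by (rule Bochner_Integration.integral_cong) (use s in \<open>auto simp: sums_iff\<close>)
  finally show ?thesis .
qed

lemma bergman_integral_eq_lborel:
  fixes g :: "complex \<Rightarrow> 'b::{banach, second_countable_topology}"
  assumes \<beta>: "\<beta> > 1" and g: "continuous_on (ball 0 1) g"
  shows "(\<integral>z. g z \<partial>bergman_measure \<beta>)
    = (\<integral>z. indicator (ball 0 1) z *\<^sub>R (((\<beta> - 1) * (1 - (norm z)\<^sup>2) powr (\<beta> - 2) / pi) *\<^sub>R g z) \<partial>lborel)"
proof -
  have "g \<in> borel_measurable (restrict_space lborel (ball 0 1))"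
    using borel_measurable_continuous_on_restrict[OF g]
    by (simp add: measurable_def space_restrict_space sets_restrict_space)
  then show ?thesis
    unfolding bergman_measure_def using \<beta>
    by (subst integral_density) (auto simp: integral_restrict_space)
qed

lemma bergman_integral_rotation:
  fixes g :: "complex \<Rightarrow> 'b::{banach, second_countable_topology}"
  assumes \<beta>: "\<beta> > 1" and g: "continuous_on UNIV g" and \<omega>: "norm \<omega> = 1" "Re \<omega> \<noteq> -1"
  shows "(\<integral>z. g (\<omega> * z) \<partial>bergman_measure \<beta>) = (\<integral>z. g z \<partial>bergman_measure \<beta>)"
proof -
  let ?G = "\<lambda>z. indicator (ball 0 1) z *\<^sub>R (((\<beta> - 1) * (1 - (norm z)\<^sup>2) powr (\<beta> - 2) / pi) *\<^sub>R g z)"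
  have "g \<in> borel_measurable borel" by (rule borel_measurable_continuous_onI[OF g])
  then have G: "?G \<in> borel_measurable borel"
    by (intro borel_measurable_scaleR borel_measurable_indicator) simp_all
  have c: "continuous_on (ball 0 1) g" "continuous_on (ball 0 1) (\<lambda>z. g (\<omega> * z))"
    using g by (auto intro!: continuous_on_compose2[OF g] continuous_intros intro: continuous_on_subset)
  have "(\<integral>z. g z \<partial>bergman_measure \<beta>) = (\<integral>z. ?G z \<partial>distr lborel borel (\<lambda>z. \<omega> * z))"
    unfolding bergman_integral_eq_lborel[OF \<beta> c(1)] lborel_distr_rotation[OF \<omega>] ..
  also have "\<dots> = (\<integral>z. ?G (\<omega> * z) \<partial>lborel)"
    by (rule integral_distr) (use G in simp_all)
  also have "\<dots> = (\<integral>z. g (\<omega> * z) \<partial>bergman_measure \<beta>)"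
    unfolding bergman_integral_eq_lborel[OF \<beta> c(2)]
    by (intro Bochner_Integration.integral_cong) (auto simp: norm_mult \<omega>(1) split: split_indicator)
  finally show ?thesis ..
qed

text \<open>
  Off the diagonal, a rotation multiplies the integral by a number different from \<open>1\<close>.
\<close>

lemma bergman_integral_monomials:
  assumes \<beta>: "\<beta> > 1"
  shows "(\<integral>z. z ^ m * cnj z ^ n \<partial>bergman_measure \<beta>)
    = (if m = n then of_real (fact n / pochhammer \<beta> n) else 0)"
proof (cases "m = n")
  case True
  have "(\<integral>z. (norm z) ^ (2 * n) \<partial>bergman_measure \<beta>) = fact n / pochhammer \<beta> n"
    by (rule integral_eq_nn_integral[THEN trans])
      (use \<beta> in \<open>auto simp: nn_integral_bergman_power pochhammer_pos less_imp_le
        intro!: bergman_measurable_continuous continuous_intros divide_nonneg_nonneg\<close>)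
  moreover have "(\<lambda>z. z ^ n * cnj z ^ n) = (\<lambda>z. of_real ((norm z) ^ (2 * n)))"
  proof
    fix z :: complex
    have "z ^ n * cnj z ^ n = (z * cnj z) ^ n" by (simp add: power_mult_distrib)
    also have "\<dots> = of_real ((norm z) ^ (2 * n))"
      by (simp only: complex_norm_square[symmetric] power_mult of_real_power)
    finally show "z ^ n * cnj z ^ n = of_real ((norm z) ^ (2 * n))" .
  qed
  ultimately have "(\<integral>z. z ^ n * cnj z ^ n \<partial>bergman_measure \<beta>) = of_real (fact n / pochhammer \<beta> n)"
    by (simp only: integral_complex_of_real)
  then show ?thesis using True by simp
next
  case False
  \<comment> \<open>With this angle the rotation multiplies \<open>z ^ m * cnj z ^ n\<close> by \<open>\<i>\<close>, and its real part is
    nonnegative, so that it is not the half-turn.\<close>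
  define \<theta> where "\<theta> = pi / (2 * (real m - real n))"
  define \<omega> where "\<omega> = cis \<theta>"
  have ne: "real m - real n \<noteq> 0" using False by simp
  have "\<bar>real m - real n\<bar> \<ge> 1" using False by linarith
  then have "\<bar>\<theta>\<bar> \<le> pi / 2"
    unfolding \<theta>_def by (simp add: abs_mult field_simps)
  then have "cos \<theta> \<ge> 0" by (intro cos_ge_zero) auto
  then have \<omega>: "norm \<omega> = 1" "Re \<omega> \<noteq> -1" by (auto simp: \<omega>_def)
  have "\<omega> ^ m * cnj \<omega> ^ n = cis (real m * \<theta>) * cis (- (real n * \<theta>))"
    by (simp add: \<omega>_def Complex.DeMoivre cis_cnj)
  also have "\<dots> = cis ((real m - real n) * \<theta>)" by (simp add: cis_mult algebra_simps)
  also have "(real m - real n) * \<theta> = pi / 2" using ne by (simp add: \<theta>_def field_simps)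
  finally have i: "\<omega> ^ m * cnj \<omega> ^ n = \<i>" by (simp add: cis_pi_half)
  let ?I = "\<integral>z. z ^ m * cnj z ^ n \<partial>bergman_measure \<beta>"
  have "?I = (\<integral>z. (\<omega> * z) ^ m * cnj (\<omega> * z) ^ n \<partial>bergman_measure \<beta>)"
    by (rule bergman_integral_rotation[OF \<beta> _ \<omega>, symmetric]) (intro continuous_intros)
  also have "\<dots> = (\<integral>z. (\<omega> ^ m * cnj \<omega> ^ n) * (z ^ m * cnj z ^ n) \<partial>bergman_measure \<beta>)"
    by (simp add: power_mult_distrib mult_ac)
  also have "\<dots> = \<i> * ?I" unfolding i by simp
  finally have "?I * (1 - \<i>) = 0" by (simp add: algebra_simps)
  then show ?thesis using False by (auto simp: complex_eq_iff)
qed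

text \<open>
  The Taylor series of \<open>g\<close> need not converge uniformly up to the circle.  The dilated functions
  \<open>z \<mapsto> g (r z)\<close> have uniformly convergent series, and \<open>r \<rightarrow> 1\<close> is covered by dominated convergence.
\<close>

lemma bergman_integral_Taylor_coefficient:
  assumes \<beta>: "\<beta> > 1" and g: "g holomorphic_on ball 0 1"
    and C: "\<And>z. z \<in> ball 0 1 \<Longrightarrow> norm (g z) \<le> C"
  shows "(\<integral>z. g z * cnj z ^ n \<partial>bergman_measure \<beta>)
    = (deriv ^^ n) g 0 / fact n * of_real (fact n / pochhammer \<beta> n)"
proof -
  interpret finite_measure "bergman_measure \<beta>" by (rule finite_measure_bergman[OF \<beta>])
  define a where "a m = (deriv ^^ m) g 0 / fact m" for m
  define L where "L = fact n / pochhammer \<beta> n"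
  have ps: "(\<lambda>m. a m * z ^ m) sums g z" if "z \<in> ball 0 1" for z
    using holomorphic_power_series[OF g that] by (simp add: a_def)
  have gc: "continuous_on (ball 0 1) g" by (rule holomorphic_on_imp_continuous_on[OF g])
  have zn: "norm (z ^ m) \<le> 1" "norm (cnj z ^ m) \<le> 1" if "z \<in> ball 0 1" for z :: complex and m
    using that by (auto simp: norm_power power_le_one)
  have mem: "of_real r * z \<in> ball 0 1" if "z \<in> ball 0 1" "0 \<le> r" "r < 1" for r and z :: complex
  proof -
    have "r * norm z \<le> norm z" using that by (simp add: mult_left_le_one_le)
    then show ?thesis using that by (simp add: norm_mult)
  qed
  have dil: "(\<integral>z. g (of_real r * z) * cnj z ^ n \<partial>bergman_measure \<beta>) = a n * of_real r ^ n * of_real L"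
    if r: "0 \<le> r" "r < 1" for r
  proof -
    obtain q where q: "r < q" "q < 1" using dense[OF r(2)] by auto
    have "summable (\<lambda>m. a m * of_real q ^ m)"
      using ps[of "of_real q"] q r by (auto simp: sums_iff)
    then have sm: "summable (\<lambda>m. norm (a m * of_real r ^ m))"
      by (rule powser_insidea) (use q r in auto)
    let ?f = "\<lambda>m z. (a m * of_real r ^ m) * (z ^ m * cnj z ^ n)"
    have "(\<lambda>m. integral\<^sup>L (bergman_measure \<beta>) (?f m)) sums (\<integral>z. g (of_real r * z) * cnj z ^ n \<partial>bergman_measure \<beta>)"
    proof (rule integral_sums_dominated[OF _ _ sm])
      show *: "norm (?f m z) \<le> norm (a m * of_real r ^ m)" if "z \<in> space (bergman_measure \<beta>)" for m z
      proof -
        have "norm (z ^ m * cnj z ^ n) \<le> 1"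
          unfolding norm_mult using zn that by (intro mult_le_one) auto
        then show ?thesis unfolding norm_mult[of "a m * of_real r ^ m"]
          by (intro mult_left_le) auto
      qed
      show "integrable (bergman_measure \<beta>) (?f m)" for m
        by (rule bergman_integrable_bounded[OF \<beta>]) (intro continuous_intros, use * in simp)
      show "(\<lambda>m. ?f m z) sums (g (of_real r * z) * cnj z ^ n)" if "z \<in> space (bergman_measure \<beta>)" for z
        using sums_mult2[OF ps[OF mem[OF _ r, of z]], of "cnj z ^ n"] that
        by (simp add: power_mult_distrib mult_ac)
    qed
    moreover have "(\<lambda>m. integral\<^sup>L (bergman_measure \<beta>) (?f m)) = (\<lambda>m. if m = n then a m * of_real r ^ m * of_real L else 0)"
      by (auto simp: bergman_integral_monomials[OF \<beta>] L_def fun_eq_iff)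
    ultimately show ?thesis
      using sums_unique2[OF _ sums_single[of n "\<lambda>m. a m * of_real r ^ m * of_real L"]] by simp
  qed
  define r where "r k = 1 - 1 / real (Suc k)" for k
  have r: "0 \<le> r k" "r k < 1" for k by (auto simp: r_def field_simps)
  have r1: "r \<longlonglongrightarrow> 1"
    unfolding r_def using tendsto_diff[OF tendsto_const[of 1] LIMSEQ_Suc[OF lim_1_over_n]] by simp
  have "(\<lambda>k. \<integral>z. g (of_real (r k) * z) * cnj z ^ n \<partial>bergman_measure \<beta>) \<longlonglongrightarrow> (\<integral>z. g z * cnj z ^ n \<partial>bergman_measure \<beta>)"
  proof (rule integral_dominated_convergence[where w = "\<lambda>_. C"])
    have gr: "continuous_on (ball 0 1) (\<lambda>z. g (of_real (r k) * z))" for k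
      by (intro continuous_on_compose2[OF gc] continuous_intros) (use mem[OF _ r] in auto)
    show "(\<lambda>z. g z * cnj z ^ n) \<in> borel_measurable (bergman_measure \<beta>)"
      by (intro bergman_measurable_continuous continuous_intros gc)
    show "(\<lambda>z. g (of_real (r k) * z) * cnj z ^ n) \<in> borel_measurable (bergman_measure \<beta>)" for k
      by (intro bergman_measurable_continuous continuous_intros gr)
    show "AE z in bergman_measure \<beta>. norm (g (of_real (r k) * z) * cnj z ^ n) \<le> C" for k
    proof (rule AE_I2)
      fix z assume "z \<in> space (bergman_measure \<beta>)"
      then have z: "z \<in> ball 0 1" by simp
      have "norm (g (of_real (r k) * z) * cnj z ^ n) \<le> norm (g (of_real (r k) * z)) * 1"
        unfolding norm_mult by (intro mult_left_mono zn z) simp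
      also have "\<dots> \<le> C" using C[OF mem[OF z r]] by simp
      finally show "norm (g (of_real (r k) * z) * cnj z ^ n) \<le> C" .
    qed
    show "AE z in bergman_measure \<beta>. (\<lambda>k. g (of_real (r k) * z) * cnj z ^ n) \<longlonglongrightarrow> g z * cnj z ^ n"
    proof (rule AE_I2)
      fix z assume "z \<in> space (bergman_measure \<beta>)"
      then have z: "z \<in> ball 0 1" by simp
      then have "isCont g z" using gc by (simp add: continuous_on_eq_continuous_at)
      moreover have "(\<lambda>k. of_real (r k) * z) \<longlonglongrightarrow> z"
        using tendsto_mult[OF tendsto_of_real[OF r1] tendsto_const[of z]] by simp
      ultimately have "(\<lambda>k. g (of_real (r k) * z)) \<longlonglongrightarrow> g z"
        by (rule isCont_tendsto_compose)
      then show "(\<lambda>k. g (of_real (r k) * z) * cnj z ^ n) \<longlonglongrightarrow> g z * cnj z ^ n"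
        by (intro tendsto_intros)
    qed
  qed simp
  moreover have "(\<lambda>k. a n * of_real (r k) ^ n * of_real L) \<longlonglongrightarrow> a n * of_real 1 ^ n * of_real L"
    by (intro tendsto_intros r1)
  ultimately have "(\<integral>z. g z * cnj z ^ n \<partial>bergman_measure \<beta>) = a n * of_real 1 ^ n * of_real L"
    unfolding dil[OF r] by (rule LIMSEQ_unique)
  then show ?thesis by (simp add: a_def L_def)
qed

lemma norm_cnj_mult_less_1:
  fixes v z :: complex
  assumes "v \<in> ball 0 1" "z \<in> cball 0 1"
  shows "norm (cnj v * z) < 1"
proof -
  have "norm (cnj v * z) \<le> norm v * 1"
    unfolding norm_mult using assms by (intro mult_mono) auto
  then show ?thesis using assms by simp
qed

lemma one_minus_cnj_mult_nonpos_Reals: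
  assumes "v \<in> ball 0 1" "z \<in> cball 0 1"
  shows "1 - cnj v * z \<notin> \<real>\<^sub>\<le>\<^sub>0"
proof -
  have "Re (cnj v * z) < 1"
    using norm_cnj_mult_less_1[OF assms] complex_Re_le_cmod[of "cnj v * z"] by linarith
  then show ?thesis by (auto simp: complex_nonpos_Reals_iff)
qed

text \<open>
  This form exhibits \<open>K v \<beta> z\<close> as an exponential function of \<open>\<beta>\<close>.  Points on the circle are
  included in order to bound the kernel by compactness.
\<close>

lemma K_eq_exp:
  assumes "v \<in> ball 0 1" "z \<in> cball 0 1"
  shows "K v \<beta> z = exp (of_real \<beta> * (- Ln (1 - cnj v * z)))"
  using one_minus_cnj_mult_nonpos_Reals[OF assms]
  by (auto simp: K_def powr_def exp_minus inverse_eq_divide)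

lemma K_sums:
  assumes "v \<in> ball 0 1" "z \<in> cball 0 1"
  shows "(\<lambda>n. of_real (pochhammer \<beta> n / fact n) * (cnj v * z) ^ n) sums K v \<beta> z"
  using negative_binomial_sums_complex[OF norm_cnj_mult_less_1[OF assms], of "of_real \<beta>"]
  by (simp add: K_def powr_minus_divide pochhammer_of_real)

lemma holomorphic_on_K:
  assumes "v \<in> ball 0 1"
  shows "K v \<beta> holomorphic_on ball 0 1"
proof -
  have "(\<lambda>z. exp (of_real \<beta> * (- Ln (1 - cnj v * z)))) holomorphic_on ball 0 1"
    by (intro holomorphic_intros one_minus_cnj_mult_nonpos_Reals[OF assms]) auto
  then show ?thesis
    by (rule holomorphic_transform) (use K_eq_exp[OF assms] in auto)
qed

lemma K_bounded:
  assumes "v \<in> ball 0 1"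
  shows "\<exists>C. \<forall>z\<in>ball 0 1. norm (K v \<beta> z) \<le> C"
proof -
  have "continuous_on (cball 0 1) (\<lambda>z. exp (of_real \<beta> * (- Ln (1 - cnj v * z))))"
    by (intro continuous_intros one_minus_cnj_mult_nonpos_Reals[OF assms]) auto
  then have "bounded ((\<lambda>z. exp (of_real \<beta> * (- Ln (1 - cnj v * z)))) ` cball 0 1)"
    by (intro compact_imp_bounded compact_continuous_image) auto
  then obtain C where "\<And>z. z \<in> cball 0 1 \<Longrightarrow> norm (exp (of_real \<beta> * (- Ln (1 - cnj v * z)))) \<le> C"
    unfolding bounded_iff by blast
  then show ?thesis
    by (intro exI[of _ C]) (use K_eq_exp[OF assms] in auto)
qed

text \<open>
  The coefficient of \<open>(cnj v * z) ^ n\<close> in the kernel is the reciprocal of the \<open>n\<close>-th moment, so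
  pairing \<open>g\<close> with the kernel restores the Taylor series of \<open>g\<close> at \<open>v\<close>.
\<close>

lemma bergman_reproducing:
  assumes \<beta>: "\<beta> > 1" and v: "v \<in> ball 0 1" and g: "g holomorphic_on ball 0 1"
    and C: "\<And>z. z \<in> ball 0 1 \<Longrightarrow> norm (g z) \<le> C"
  shows "(\<integral>z. g z * cnj (K v \<beta> z) \<partial>bergman_measure \<beta>) = g v"
proof -
  interpret finite_measure "bergman_measure \<beta>" by (rule finite_measure_bergman[OF \<beta>])
  let ?b = "\<lambda>n. pochhammer \<beta> n / fact n"
  let ?f = "\<lambda>n z. (of_real (?b n) * v ^ n) * (g z * cnj z ^ n)"
  have gc: "continuous_on (ball 0 1) g" by (rule holomorphic_on_imp_continuous_on[OF g])
  have pp: "pochhammer \<beta> n > 0" for n using \<beta> by (simp add: pochhammer_pos)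
  have C0: "C \<ge> 0" using C[of 0] norm_ge_zero[of "g 0"] by (simp del: norm_ge_zero)
  have "(\<lambda>n. integral\<^sup>L (bergman_measure \<beta>) (?f n)) sums (\<integral>z. g z * cnj (K v \<beta> z) \<partial>bergman_measure \<beta>)"
  proof (rule integral_sums_dominated[where b = "\<lambda>n. ?b n * norm v ^ n * C"])
    show *: "norm (?f n z) \<le> ?b n * norm v ^ n * C" if "z \<in> space (bergman_measure \<beta>)" for n z
    proof -
      have "norm (g z * cnj z ^ n) \<le> C * 1"
        unfolding norm_mult using that C C0 by (intro mult_mono) (auto simp: norm_power power_le_one)
      then show ?thesis
        unfolding norm_mult[of "of_real (?b n) * v ^ n"]
        using pp[of n] by (intro mult_mono) (auto simp: norm_mult norm_power norm_divide)
    qed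
    show "integrable (bergman_measure \<beta>) (?f n)" for n
      by (rule bergman_integrable_bounded[OF \<beta>]) (intro continuous_intros gc, use * in simp)
    have "summable (\<lambda>n. ?b n * norm v ^ n)"
      using negative_binomial_sums_real[of "norm v" \<beta>] v by (auto simp: sums_iff)
    then show "summable (\<lambda>n. ?b n * norm v ^ n * C)" by (rule summable_mult2)
    show "(\<lambda>n. ?f n z) sums (g z * cnj (K v \<beta> z))" if "z \<in> space (bergman_measure \<beta>)" for z
    proof -
      have "(\<lambda>n. cnj (of_real (?b n) * (cnj v * z) ^ n)) sums cnj (K v \<beta> z)"
        unfolding sums_cnj by (rule K_sums) (use v that in auto)
      from sums_mult[OF this, of "g z"] show ?thesis
        by (simp add: power_mult_distrib mult_ac)
    qed
  qed
  moreover have "(\<lambda>n. integral\<^sup>L (bergman_measure \<beta>) (?f n)) = (\<lambda>n. (deriv ^^ n) g 0 / fact n * v ^ n)"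
  proof
    fix n
    have "(\<integral>z. g z * cnj z ^ n \<partial>bergman_measure \<beta>) = (deriv ^^ n) g 0 / fact n * of_real (fact n / pochhammer \<beta> n)"
      by (rule bergman_integral_Taylor_coefficient[OF \<beta> g C])
    then show "integral\<^sup>L (bergman_measure \<beta>) (?f n) = (deriv ^^ n) g 0 / fact n * v ^ n"
      using pp[of n] by simp
  qed
  moreover have "(\<lambda>n. (deriv ^^ n) g 0 / fact n * v ^ n) sums g v"
    using holomorphic_power_series[OF g v] by simp
  ultimately show ?thesis by (simp only: sums_unique2)
qed

section \<open>Differentiation in the weight parameter\<close>

lemma abs_exp_minus_1_le:
  fixes y :: real
  shows "\<bar>exp y - 1\<bar> \<le> \<bar>y\<bar> * exp \<bar>y\<bar>"
proof (cases "y \<ge> 0")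
  case True
  have "(1 - y) * exp y \<le> exp (- y) * exp y"
    using exp_ge_add_one_self[of "- y"] by (intro mult_right_mono) auto
  then show ?thesis using True by (simp add: algebra_simps flip: exp_add)
next
  case False
  have "1 - exp y \<le> - y" using exp_ge_add_one_self[of y] by linarith
  then have "1 - exp y \<le> \<bar>y\<bar> * 1" using False by simp
  also have "\<dots> \<le> \<bar>y\<bar> * exp \<bar>y\<bar>" by (intro mult_left_mono) auto
  finally show ?thesis using False by simp
qed

text \<open>
  A majorant of the difference quotients by two exponentials of the same kind, with parameters on
  either side of \<open>b\<close>, so that integrability of the exponentials suffices for domination.
\<close>

lemma exp_difference_quotient_bound:
  fixes b t \<delta> B :: real
  assumes "t \<noteq> 0" "\<bar>t\<bar> \<le> \<delta>"
  shows "\<bar>(exp ((b + t) * B) - exp (b * B)) / t\<bar>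
    \<le> (exp ((b + 2 * \<delta>) * B) + exp ((b - 2 * \<delta>) * B)) / \<delta>"
proof -
  have \<delta>: "\<delta> > 0" using assms by linarith
  have "\<bar>exp (t * B) - 1\<bar> \<le> \<bar>t * B\<bar> * exp \<bar>t * B\<bar>" by (rule abs_exp_minus_1_le)
  also have "\<dots> \<le> \<bar>t * B\<bar> * exp (\<delta> * \<bar>B\<bar>)"
    using assms by (intro mult_left_mono) (auto simp: abs_mult mult_right_mono)
  finally have "\<bar>exp (t * B) - 1\<bar> / \<bar>t\<bar> \<le> \<bar>B\<bar> * exp (\<delta> * \<bar>B\<bar>)"
    using assms(1) by (simp add: field_simps abs_mult)
  also have "\<dots> \<le> exp (\<delta> * \<bar>B\<bar>) / \<delta> * exp (\<delta> * \<bar>B\<bar>)"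
  proof (intro mult_right_mono)
    have "\<delta> * \<bar>B\<bar> \<le> exp (\<delta> * \<bar>B\<bar>)" using exp_ge_add_one_self[of "\<delta> * \<bar>B\<bar>"] by linarith
    then show "\<bar>B\<bar> \<le> exp (\<delta> * \<bar>B\<bar>) / \<delta>" using \<delta> by (simp add: field_simps)
  qed simp
  also have "\<dots> = exp (2 * \<delta> * \<bar>B\<bar>) / \<delta>" by (simp flip: exp_add)
  also have "\<dots> \<le> (exp (2 * \<delta> * B) + exp (- 2 * \<delta> * B)) / \<delta>"
    using \<delta> by (intro divide_right_mono) (auto simp: abs_if)
  finally have q: "\<bar>exp (t * B) - 1\<bar> / \<bar>t\<bar> \<le> (exp (2 * \<delta> * B) + exp (- 2 * \<delta> * B)) / \<delta>" .
  have "\<bar>(exp ((b + t) * B) - exp (b * B)) / t\<bar> = exp (b * B) * (\<bar>exp (t * B) - 1\<bar> / \<bar>t\<bar>)"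
  proof -
    have "exp ((b + t) * B) - exp (b * B) = exp (b * B) * (exp (t * B) - 1)"
      by (simp add: algebra_simps exp_add)
    then show ?thesis by (simp add: abs_mult abs_divide)
  qed
  also have "\<dots> \<le> exp (b * B) * ((exp (2 * \<delta> * B) + exp (- 2 * \<delta> * B)) / \<delta>)"
    by (intro mult_left_mono q) simp
  also have "\<dots> = (exp ((b + 2 * \<delta>) * B) + exp ((b - 2 * \<delta>) * B)) / \<delta>"
    by (simp add: algebra_simps exp_add exp_diff exp_minus field_simps)
  finally show ?thesis .
qed

text \<open>
  The difference quotients at \<open>b\<close> are dominated by exponentials with the parameters \<open>b + 2 \<delta>\<close> and
  \<open>b - 2 \<delta>\<close>, which lie in the range of integrability for \<open>3 \<delta> = b - a\<close>.
\<close>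

lemma integral_exp_differentiable:
  fixes g B :: "'a \<Rightarrow> real"
  assumes [measurable]: "g \<in> borel_measurable M" "B \<in> borel_measurable M"
    and int: "\<And>\<beta>. a < \<beta> \<Longrightarrow> integrable M (\<lambda>x. g x * exp (\<beta> * B x))"
    and b: "a < b"
  shows "((\<lambda>\<beta>. \<integral>x. g x * exp (\<beta> * B x) \<partial>M) has_real_derivative (\<integral>x. g x * (B x * exp (b * B x)) \<partial>M)) (at b)"
proof -
  define \<delta> where "\<delta> = (b - a) / 3"
  have \<delta>: "\<delta> > 0" "a < b - 2 * \<delta>" using b by (auto simp: \<delta>_def field_simps)
  let ?q = "\<lambda>t x. g x * ((exp ((b + t) * B x) - exp (b * B x)) / t)"
  have "((\<lambda>t. ((\<integral>x. g x * exp ((b + t) * B x) \<partial>M) - (\<integral>x. g x * exp (b * B x) \<partial>M)) / t)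
      \<longlongrightarrow> (\<integral>x. g x * (B x * exp (b * B x)) \<partial>M)) (at 0)"
    unfolding tendsto_at_iff_sequentially comp_def
  proof (intro allI impI)
    fix X :: "nat \<Rightarrow> real"
    assume X0: "\<forall>i. X i \<in> UNIV - {0}" and X: "X \<longlonglongrightarrow> 0"
    from X \<delta>(1) obtain n0 where n0: "\<And>n. n \<ge> n0 \<Longrightarrow> \<bar>X n\<bar> \<le> \<delta>"
      unfolding LIMSEQ_iff by (metis diff_zero less_imp_le real_norm_def)
    define Y where "Y n = X (n + n0)" for n
    have Y: "Y n \<noteq> 0" "\<bar>Y n\<bar> \<le> \<delta>" for n using X0 n0 by (auto simp: Y_def)
    have Y0: "Y \<longlonglongrightarrow> 0" unfolding Y_def by (rule LIMSEQ_ignore_initial_segment[OF X])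
    have "(\<lambda>n. \<integral>x. ?q (Y n) x \<partial>M) \<longlonglongrightarrow> (\<integral>x. g x * (B x * exp (b * B x)) \<partial>M)"
    proof (rule integral_dominated_convergence)
      show "integrable M (\<lambda>x. (\<bar>g x * exp ((b + 2 * \<delta>) * B x)\<bar> + \<bar>g x * exp ((b - 2 * \<delta>) * B x)\<bar>) / \<delta>)"
        using \<delta> by (intro integrable_divide Bochner_Integration.integrable_add integrable_abs int) auto
      show "AE x in M. norm (?q (Y n) x) \<le> (\<bar>g x * exp ((b + 2 * \<delta>) * B x)\<bar> + \<bar>g x * exp ((b - 2 * \<delta>) * B x)\<bar>) / \<delta>" for n
      proof (rule AE_I2)
        fix x
        have "norm (?q (Y n) x) \<le> \<bar>g x\<bar> * ((exp ((b + 2 * \<delta>) * B x) + exp ((b - 2 * \<delta>) * B x)) / \<delta>)"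
          unfolding real_norm_def abs_mult
          by (intro mult_left_mono exp_difference_quotient_bound Y) simp
        then show "norm (?q (Y n) x) \<le> (\<bar>g x * exp ((b + 2 * \<delta>) * B x)\<bar> + \<bar>g x * exp ((b - 2 * \<delta>) * B x)\<bar>) / \<delta>"
          by (simp add: abs_mult distrib_left)
      qed
      show "AE x in M. (\<lambda>n. ?q (Y n) x) \<longlonglongrightarrow> g x * (B x * exp (b * B x))"
      proof (rule AE_I2)
        fix x
        have "((\<lambda>\<beta>. exp (\<beta> * B x)) has_real_derivative B x * exp (b * B x)) (at b)"
          by (auto intro!: derivative_eq_intros)
        then have "((\<lambda>t. (exp ((b + t) * B x) - exp (b * B x)) / t) \<longlongrightarrow> B x * exp (b * B x)) (at 0)"
          unfolding DERIV_def .
        then have "(\<lambda>n. (exp ((b + Y n) * B x) - exp (b * B x)) / Y n) \<longlonglongrightarrow> B x * exp (b * B x)"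
          unfolding tendsto_at_iff_sequentially comp_def using Y(1) Y0 by auto
        then show "(\<lambda>n. ?q (Y n) x) \<longlonglongrightarrow> g x * (B x * exp (b * B x))"
          by (intro tendsto_intros)
      qed
    qed measurable
    moreover have "(\<integral>x. ?q (Y n) x \<partial>M) = ((\<integral>x. g x * exp ((b + Y n) * B x) \<partial>M) - (\<integral>x. g x * exp (b * B x) \<partial>M)) / Y n" for n
    proof -
      have "a < b + Y n" using Y(2)[of n] \<delta> by linarith
      then have "(\<integral>x. g x * exp ((b + Y n) * B x) - g x * exp (b * B x) \<partial>M)
          = (\<integral>x. g x * exp ((b + Y n) * B x) \<partial>M) - (\<integral>x. g x * exp (b * B x) \<partial>M)"
        by (intro Bochner_Integration.integral_diff int b)
      moreover have "?q (Y n) x = (g x * exp ((b + Y n) * B x) - g x * exp (b * B x)) / Y n" for x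
        by (simp add: right_diff_distrib)
      ultimately show ?thesis by (simp only: integral_divide_zero)
    qed
    ultimately have "(\<lambda>n. ((\<integral>x. g x * exp ((b + Y n) * B x) \<partial>M) - (\<integral>x. g x * exp (b * B x) \<partial>M)) / Y n)
        \<longlonglongrightarrow> (\<integral>x. g x * (B x * exp (b * B x)) \<partial>M)" by (simp only:)
    then show "(\<lambda>n. ((\<integral>x. g x * exp ((b + X n) * B x) \<partial>M) - (\<integral>x. g x * exp (b * B x) \<partial>M)) / X n)
        \<longlonglongrightarrow> (\<integral>x. g x * (B x * exp (b * B x)) \<partial>M)"
      unfolding Y_def by (rule LIMSEQ_offset)
  qed
  then show ?thesis unfolding DERIV_def .
qed

lemma one_minus_norm_square_pos: "z \<in> ball (0::complex) 1 \<Longrightarrow> 0 < 1 - (norm z)\<^sup>2"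
  by (simp add: abs_square_less_1)

text \<open>
  The weight \<open>(1 - |z|\<^sup>2)\<close> to the power \<open>\<beta>\<close> is itself exponential in \<open>\<beta>\<close>, so up to the factor \<open>\<beta> - 1\<close> the
  integral has the form \<open>\<integral> g exp (\<beta> B)\<close> with \<open>B = 2 Re h + ln (1 - |z|\<^sup>2)\<close>.
\<close>

lemma bergman_norm_differentiable:
  fixes h :: "complex \<Rightarrow> complex"
  assumes h: "h holomorphic_on ball 0 1" and C: "\<And>z. z \<in> ball 0 1 \<Longrightarrow> \<bar>Re (h z)\<bar> \<le> C" and \<alpha>: "\<alpha> > 1"
  obtains D where "((\<lambda>\<beta>. \<integral>z. exp (2 * \<beta> * Re (h z)) \<partial>bergman_measure \<beta>) has_real_derivative D) (at \<alpha>)"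
proof -
  let ?M = "restrict_space lborel (ball (0::complex) 1)"
  define g where "g z = (1 - (norm z)\<^sup>2) powr (- 2) / pi" for z :: complex
  define B where "B z = 2 * Re (h z) + ln (1 - (norm z)\<^sup>2)" for z
  have hc: "continuous_on (ball 0 1) (\<lambda>z. Re (h z))"
    by (intro continuous_intros holomorphic_on_imp_continuous_on[OF h])
  then have [measurable]: "(\<lambda>z. Re (h z)) \<in> borel_measurable ?M"
    using borel_measurable_continuous_on_restrict[OF hc]
    by (simp add: measurable_def space_restrict_space sets_restrict_space)
  have [measurable]: "g \<in> borel_measurable ?M"
    unfolding g_def by (rule measurable_restrict_space1) measurable
  have [measurable]: "(\<lambda>z. ln (1 - (norm z)\<^sup>2)) \<in> borel_measurable ?M"
    by (rule measurable_restrict_space1) measurable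
  have [measurable]: "B \<in> borel_measurable ?M" unfolding B_def by measurable
  have eq: "((\<beta> - 1) * (1 - (norm z)\<^sup>2) powr (\<beta> - 2) / pi) * exp (2 * \<beta> * Re (h z)) = (\<beta> - 1) * (g z * exp (\<beta> * B z))"
    if "z \<in> space ?M" for z \<beta>
  proof -
    have pos: "1 - (norm z)\<^sup>2 > 0" using one_minus_norm_square_pos that by (simp add: space_restrict_space)
    have "(1 - (norm z)\<^sup>2) powr (\<beta> - 2) = (1 - (norm z)\<^sup>2) powr (- 2) * exp (\<beta> * ln (1 - (norm z)\<^sup>2))"
      using pos by (simp add: powr_def algebra_simps flip: exp_add)
    then show ?thesis by (simp add: g_def B_def algebra_simps exp_add)
  qed
  have meas: "(\<lambda>z. exp (2 * \<beta> * Re (h z))) \<in> borel_measurable ?M" for \<beta> by measurable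
  have int: "integrable ?M (\<lambda>z. g z * exp (\<beta> * B z))" if \<beta>: "1 < \<beta>" for \<beta>
  proof -
    have "integrable (bergman_measure \<beta>) (\<lambda>z. exp (2 * \<beta> * Re (h z)))"
    proof (rule bergman_integrable_bounded[OF \<beta>, where C = "exp (2 * \<beta> * C)"])
      show "continuous_on (ball 0 1) (\<lambda>z. exp (2 * \<beta> * Re (h z)))" by (intro continuous_intros hc)
      show "norm (exp (2 * \<beta> * Re (h z))) \<le> exp (2 * \<beta> * C)" if "z \<in> ball 0 1" for z
        using C[OF that] \<beta> by (simp add: abs_le_iff)
    qed
    then have "integrable ?M (\<lambda>z. ((\<beta> - 1) * (1 - (norm z)\<^sup>2) powr (\<beta> - 2) / pi) * exp (2 * \<beta> * Re (h z)))"
      unfolding bergman_measure_def using \<beta> meas by (subst (asm) integrable_density) auto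
    then have "integrable ?M (\<lambda>z. (\<beta> - 1) * (g z * exp (\<beta> * B z)))"
      by (subst (asm) Bochner_Integration.integrable_cong[OF refl eq])
    then show ?thesis using \<beta> by simp
  qed
  let ?J = "\<lambda>\<beta>. \<integral>z. g z * exp (\<beta> * B z) \<partial>?M"
  have "(?J has_real_derivative (\<integral>z. g z * (B z * exp (\<alpha> * B z)) \<partial>?M)) (at \<alpha>)"
    by (rule integral_exp_differentiable[OF _ _ int \<alpha>]) measurable
  then have 1: "((\<lambda>\<beta>. (\<beta> - 1) * ?J \<beta>) has_real_derivative
      ?J \<alpha> + (\<integral>z. g z * (B z * exp (\<alpha> * B z)) \<partial>?M) * (\<alpha> - 1)) (at \<alpha>)"
    by (auto intro!: derivative_eq_intros)
  have 2: "(\<beta> - 1) * ?J \<beta> = (\<integral>z. exp (2 * \<beta> * Re (h z)) \<partial>bergman_measure \<beta>)" if "\<beta> \<in> {1<..}" for \<beta>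
  proof -
    have "(\<integral>z. exp (2 * \<beta> * Re (h z)) \<partial>bergman_measure \<beta>)
        = (\<integral>z. ((\<beta> - 1) * (1 - (norm z)\<^sup>2) powr (\<beta> - 2) / pi) * exp (2 * \<beta> * Re (h z)) \<partial>?M)"
      unfolding bergman_measure_def using that meas by (subst integral_density) auto
    also have "\<dots> = (\<integral>z. (\<beta> - 1) * (g z * exp (\<beta> * B z)) \<partial>?M)"
      by (rule Bochner_Integration.integral_cong[OF refl eq])
    finally show ?thesis by simp
  qed
  have "((\<lambda>\<beta>. \<integral>z. exp (2 * \<beta> * Re (h z)) \<partial>bergman_measure \<beta>) has_real_derivative
      ?J \<alpha> + (\<integral>z. g z * (B z * exp (\<alpha> * B z)) \<partial>?M) * (\<alpha> - 1)) (at \<alpha>)"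
    by (rule has_field_derivative_transform_within_open[OF 1 _ _ 2, of "{1<..}"]) (use \<alpha> in auto)
  then show ?thesis by (rule that)
qed

section \<open>The derivative of the weighted norm of a combination of kernels\<close>

lemma bergman_inner_kernel_sum:
  assumes \<beta>: "\<beta> > 1" and A: "finite A" and v: "\<And>i. i \<in> A \<Longrightarrow> v i \<in> ball 0 1"
    and g: "g holomorphic_on ball 0 1" and C: "\<And>z. z \<in> ball 0 1 \<Longrightarrow> norm (g z) \<le> C"
  shows "(\<integral>z. g z * cnj (\<Sum>i\<in>A. c i * K (v i) \<beta> z) \<partial>bergman_measure \<beta>) = (\<Sum>i\<in>A. cnj (c i) * g (v i))"
proof -
  have int: "integrable (bergman_measure \<beta>) (\<lambda>z. g z * cnj (K (v i) \<beta> z))" if "i \<in> A" for i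
  proof -
    obtain C' where C': "\<And>z. z \<in> ball 0 1 \<Longrightarrow> norm (K (v i) \<beta> z) \<le> C'"
      using K_bounded[OF v[OF \<open>i \<in> A\<close>]] by blast
    show ?thesis
    proof (rule bergman_integrable_bounded[OF \<beta>, where C = "C * C'"])
      show "continuous_on (ball 0 1) (\<lambda>z. g z * cnj (K (v i) \<beta> z))"
        by (intro continuous_intros holomorphic_on_imp_continuous_on g holomorphic_on_K v that)
      show "norm (g z * cnj (K (v i) \<beta> z)) \<le> C * C'" if "z \<in> ball 0 1" for z
        using C[OF that] C'[OF that] order_trans[OF norm_ge_zero C[OF that]] unfolding norm_mult complex_mod_cnj
        by (intro mult_mono) auto
    qed
  qed
  have "(\<integral>z. g z * cnj (\<Sum>i\<in>A. c i * K (v i) \<beta> z) \<partial>bergman_measure \<beta>)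
      = (\<integral>z. (\<Sum>i\<in>A. cnj (c i) * (g z * cnj (K (v i) \<beta> z))) \<partial>bergman_measure \<beta>)"
    by (simp add: sum_distrib_left mult_ac)
  also have "\<dots> = (\<Sum>i\<in>A. \<integral>z. cnj (c i) * (g z * cnj (K (v i) \<beta> z)) \<partial>bergman_measure \<beta>)"
    by (intro Bochner_Integration.integral_sum integrable_mult_right int)
  also have "\<dots> = (\<Sum>i\<in>A. cnj (c i) * g (v i))"
  proof (intro sum.cong refl)
    fix i assume "i \<in> A"
    have "(\<integral>z. g z * cnj (K (v i) \<beta> z) \<partial>bergman_measure \<beta>) = g (v i)"
      by (rule bergman_reproducing[OF \<beta> v[OF \<open>i \<in> A\<close>] g C])
    then show "(\<integral>z. cnj (c i) * (g z * cnj (K (v i) \<beta> z)) \<partial>bergman_measure \<beta>) = cnj (c i) * g (v i)"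
      by simp
  qed
  finally show ?thesis .
qed

text \<open>
  The difference of the two sides is the square norm of \<open>exp (\<beta> h) - q\<close>, expanded with the
  reproducing property.
\<close>

lemma bergman_norm_lower_bound:
  fixes h :: "complex \<Rightarrow> complex" and c v :: "'i \<Rightarrow> complex"
  assumes h: "h holomorphic_on ball 0 1" and C: "\<And>z. z \<in> ball 0 1 \<Longrightarrow> \<bar>Re (h z)\<bar> \<le> C" and \<beta>: "\<beta> > 1"
    and A: "finite A" and v: "\<And>i. i \<in> A \<Longrightarrow> v i \<in> ball 0 1"
  defines "q \<equiv> \<lambda>z. \<Sum>i\<in>A. c i * K (v i) \<beta> z"
  defines "R \<equiv> 2 * Re (\<Sum>i\<in>A. cnj (c i) * exp (of_real \<beta> * h (v i))) - Re (\<Sum>i\<in>A. cnj (c i) * q (v i))"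
  shows "R \<le> (\<integral>z. exp (2 * \<beta> * Re (h z)) \<partial>bergman_measure \<beta>)"
    and "(\<And>z. z \<in> ball 0 1 \<Longrightarrow> exp (of_real \<beta> * h z) = q z) \<Longrightarrow>
      (\<integral>z. exp (2 * \<beta> * Re (h z)) \<partial>bergman_measure \<beta>) = R"
proof -
  let ?M = "bergman_measure \<beta>"
  define g where "g z = exp (of_real \<beta> * h z)" for z
  have g: "g holomorphic_on ball 0 1" unfolding g_def by (intro holomorphic_intros h)
  have gC: "norm (g z) \<le> exp (\<beta> * C)" if "z \<in> ball 0 1" for z
    using C[OF that] \<beta> by (simp add: g_def abs_le_iff)
  have q: "q holomorphic_on ball 0 1"
    unfolding q_def by (intro holomorphic_intros holomorphic_on_K v)
  have "\<forall>i\<in>A. \<exists>b. \<forall>z\<in>ball 0 1. norm (K (v i) \<beta> z) \<le> b"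
    using K_bounded[OF v] by blast
  then obtain C' where C': "\<And>i z. i \<in> A \<Longrightarrow> z \<in> ball 0 1 \<Longrightarrow> norm (K (v i) \<beta> z) \<le> C' i"
    unfolding bchoice_iff by blast
  define Cq where "Cq = (\<Sum>i\<in>A. norm (c i) * C' i)"
  have qC: "norm (q z) \<le> Cq" if "z \<in> ball 0 1" for z
    unfolding q_def Cq_def
    by (intro sum_norm_le) (auto simp: norm_mult intro!: mult_left_mono C' that)
  have cont: "continuous_on (ball 0 1) g" "continuous_on (ball 0 1) q"
    using g q by (auto intro: holomorphic_on_imp_continuous_on)
  have int: "integrable ?M (\<lambda>z. F z * cnj (G z))"
    if "continuous_on (ball 0 1) F" "continuous_on (ball 0 1) G"
      "\<And>z. z \<in> ball 0 1 \<Longrightarrow> norm (F z) \<le> a" "\<And>z. z \<in> ball 0 1 \<Longrightarrow> norm (G z) \<le> b" for F G a b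
  proof (rule bergman_integrable_bounded[OF \<beta>, where C = "a * b"])
    show "continuous_on (ball 0 1) (\<lambda>z. F z * cnj (G z))" by (intro continuous_intros that(1,2))
    show "norm (F z * cnj (G z)) \<le> a * b" if "z \<in> ball 0 1" for z
      using \<open>\<And>z. z \<in> ball 0 1 \<Longrightarrow> norm (F z) \<le> a\<close>[OF that] \<open>\<And>z. z \<in> ball 0 1 \<Longrightarrow> norm (G z) \<le> b\<close>[OF that]
        order_trans[OF norm_ge_zero \<open>\<And>z. z \<in> ball 0 1 \<Longrightarrow> norm (F z) \<le> a\<close>[OF that]] unfolding norm_mult complex_mod_cnj
      by (intro mult_mono) auto
  qed
  note ints = int[OF cont(1,1) gC gC] int[OF cont(1,2) gC qC] int[OF cont(2,2) qC qC]
  have gg: "exp (2 * \<beta> * Re (h z)) = Re (g z * cnj (g z))" for z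
    unfolding complex_norm_square[symmetric] by (simp add: g_def power2_eq_square flip: exp_add)
  have gq: "(\<integral>z. g z * cnj (q z) \<partial>?M) = (\<Sum>i\<in>A. cnj (c i) * g (v i))"
    unfolding q_def by (rule bergman_inner_kernel_sum[OF \<beta> A v g gC])
  have qq: "(\<integral>z. q z * cnj (q z) \<partial>?M) = (\<Sum>i\<in>A. cnj (c i) * q (v i))"
    by (subst (2) q_def) (rule bergman_inner_kernel_sum[OF \<beta> A v q qC])
  have "(norm (g z - q z))\<^sup>2 = Re (g z * cnj (g z) - 2 * (g z * cnj (q z)) + q z * cnj (q z))" for z
    unfolding cmod_power2 by (simp add: power2_eq_square algebra_simps)
  then have "(\<integral>z. (norm (g z - q z))\<^sup>2 \<partial>?M)
      = (\<integral>z. Re (g z * cnj (g z) - 2 * (g z * cnj (q z)) + q z * cnj (q z)) \<partial>?M)" by simp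
  also have "\<dots> = Re (\<integral>z. g z * cnj (g z) - 2 * (g z * cnj (q z)) + q z * cnj (q z) \<partial>?M)"
    by (intro integral_Re Bochner_Integration.integrable_add Bochner_Integration.integrable_diff integrable_mult_right ints)
  also have "(\<integral>z. g z * cnj (g z) - 2 * (g z * cnj (q z)) + q z * cnj (q z) \<partial>?M)
      = (\<integral>z. g z * cnj (g z) \<partial>?M) - 2 * (\<integral>z. g z * cnj (q z) \<partial>?M) + (\<integral>z. q z * cnj (q z) \<partial>?M)"
    using ints by (simp add: Bochner_Integration.integral_add Bochner_Integration.integral_diff)
  also have "Re \<dots> = (\<integral>z. exp (2 * \<beta> * Re (h z)) \<partial>?M) - R"
    unfolding gq qq using integral_Re[OF ints(1)] by (simp add: gg R_def g_def)
  finally have eq: "(\<integral>z. (norm (g z - q z))\<^sup>2 \<partial>?M) = (\<integral>z. exp (2 * \<beta> * Re (h z)) \<partial>?M) - R" .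
  moreover have "(\<integral>z. (norm (g z - q z))\<^sup>2 \<partial>?M) \<ge> 0" by (intro Bochner_Integration.integral_nonneg) simp
  ultimately show "R \<le> (\<integral>z. exp (2 * \<beta> * Re (h z)) \<partial>?M)" by simp
  assume "\<And>z. z \<in> ball 0 1 \<Longrightarrow> exp (of_real \<beta> * h z) = q z"
  then have "(\<integral>z. (norm (g z - q z))\<^sup>2 \<partial>?M) = (\<integral>z. 0 \<partial>?M)"
    by (intro Bochner_Integration.integral_cong) (auto simp: g_def)
  with eq show "(\<integral>z. exp (2 * \<beta> * Re (h z)) \<partial>?M) = R" by simp
qed

lemma has_vector_derivative_exp_of_real_mult:
  "((\<lambda>\<beta>. exp (of_real \<beta> * s)) has_vector_derivative s * exp (of_real \<beta> * s)) (at \<beta>)" for s :: complex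
proof -
  have "((\<lambda>z. exp (z * s)) has_field_derivative exp (of_real \<beta> * s) * s) (at (of_real \<beta>))"
    by (auto intro!: derivative_eq_intros)
  then show ?thesis
    using has_vector_derivative_real_field by (fastforce simp: mult.commute)
qed

text \<open>
  The lower bound \<open>R \<beta>\<close> from \<open>bergman_norm_lower_bound\<close> is attained at \<open>\<alpha>\<close>, so \<open>I - R\<close> has a minimum
  there and \<open>I\<close> has the derivative of the finite sum \<open>R\<close>.
\<close>

lemma bergman_norm_derivative:
  fixes h :: "complex \<Rightarrow> complex" and c v :: "'i \<Rightarrow> complex"
  assumes h: "h holomorphic_on ball 0 1" and C: "\<And>z. z \<in> ball 0 1 \<Longrightarrow> \<bar>Re (h z)\<bar> \<le> C" and \<alpha>: "\<alpha> > 1"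
    and A: "finite A" and v: "\<And>i. i \<in> A \<Longrightarrow> v i \<in> ball 0 1"
    and rep: "\<And>z. z \<in> ball 0 1 \<Longrightarrow> exp (of_real \<alpha> * h z) = (\<Sum>i\<in>A. c i * K (v i) \<alpha> z)"
  defines "I \<equiv> \<lambda>\<beta>. \<integral>z. exp (2 * \<beta> * Re (h z)) \<partial>bergman_measure \<beta>"
  shows "I \<alpha> = Re (\<Sum>i\<in>A. cnj (c i) * exp (of_real \<alpha> * h (v i)))"
    and "(I has_real_derivative
      2 * Re (\<Sum>i\<in>A. cnj (c i) * (h (v i) * exp (of_real \<alpha> * h (v i))))
      + Re (\<Sum>i\<in>A. cnj (c i) * (\<Sum>j\<in>A. c j * (Ln (1 - cnj (v j) * v i) * K (v j) \<alpha> (v i))))) (at \<alpha>)"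
proof -
  define R where "R \<beta> = 2 * Re (\<Sum>i\<in>A. cnj (c i) * exp (of_real \<beta> * h (v i)))
      - Re (\<Sum>i\<in>A. cnj (c i) * (\<Sum>j\<in>A. c j * K (v j) \<beta> (v i)))" for \<beta>
  define s where "s i j = - Ln (1 - cnj (v j) * v i)" for i j
  have K: "K (v j) \<beta> (v i) = exp (of_real \<beta> * s i j)" if "i \<in> A" "j \<in> A" for i j \<beta>
    using K_eq_exp[OF v[OF that(2)], of "v i" \<beta>] v[OF that(1)] by (simp add: s_def)
  have le: "R \<beta> \<le> I \<beta>" if "\<beta> > 1" for \<beta>
    unfolding R_def I_def by (rule bergman_norm_lower_bound(1)[OF h C that A v])
  have eq: "I \<alpha> = R \<alpha>"
    unfolding R_def I_def by (rule bergman_norm_lower_bound(2)[OF h C \<alpha> A v rep])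
  show "I \<alpha> = Re (\<Sum>i\<in>A. cnj (c i) * exp (of_real \<alpha> * h (v i)))"
    unfolding eq R_def using rep v by simp
  let ?R' = "2 * Re (\<Sum>i\<in>A. cnj (c i) * (h (v i) * exp (of_real \<alpha> * h (v i))))
      - Re (\<Sum>i\<in>A. cnj (c i) * (\<Sum>j\<in>A. c j * (s i j * exp (of_real \<alpha> * s i j))))"
  have R: "(R has_real_derivative ?R') (at \<alpha>)"
  proof -
    have "((\<lambda>\<beta>. Re (\<Sum>i\<in>A. cnj (c i) * exp (of_real \<beta> * h (v i)))) has_vector_derivative
        Re (\<Sum>i\<in>A. cnj (c i) * (h (v i) * exp (of_real \<alpha> * h (v i))))) (at \<alpha>)"
      by (intro bounded_linear.has_vector_derivative[OF bounded_linear_Re] has_vector_derivative_sum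
          bounded_linear.has_vector_derivative[OF bounded_linear_mult_right] has_vector_derivative_exp_of_real_mult)
    moreover have "((\<lambda>\<beta>. Re (\<Sum>i\<in>A. cnj (c i) * (\<Sum>j\<in>A. c j * exp (of_real \<beta> * s i j)))) has_vector_derivative
        Re (\<Sum>i\<in>A. cnj (c i) * (\<Sum>j\<in>A. c j * (s i j * exp (of_real \<alpha> * s i j))))) (at \<alpha>)"
      by (intro bounded_linear.has_vector_derivative[OF bounded_linear_Re] has_vector_derivative_sum
          bounded_linear.has_vector_derivative[OF bounded_linear_mult_right] has_vector_derivative_exp_of_real_mult)
    moreover have "R = (\<lambda>\<beta>. 2 * Re (\<Sum>i\<in>A. cnj (c i) * exp (of_real \<beta> * h (v i)))
       - Re (\<Sum>i\<in>A. cnj (c i) * (\<Sum>j\<in>A. c j * exp (of_real \<beta> * s i j))))"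
      by (simp add: R_def fun_eq_iff K)
    ultimately show ?thesis
      by (simp only: has_real_derivative_iff_has_vector_derivative[symmetric]) (intro DERIV_diff DERIV_cmult)
  qed
  obtain D where D: "(I has_real_derivative D) (at \<alpha>)"
    using bergman_norm_differentiable[OF h C \<alpha>] unfolding I_def by blast
  have 1: "D - ?R' = 0"
  proof (rule DERIV_local_min[OF DERIV_diff[OF D R]])
    show "0 < \<alpha> - 1" using \<alpha> by simp
    show "\<forall>\<beta>. \<bar>\<alpha> - \<beta>\<bar> < \<alpha> - 1 \<longrightarrow> I \<alpha> - R \<alpha> \<le> I \<beta> - R \<beta>"
      using le eq by (auto simp: abs_less_iff)
  qed
  have 2: "?R' = 2 * Re (\<Sum>i\<in>A. cnj (c i) * (h (v i) * exp (of_real \<alpha> * h (v i))))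
      + Re (\<Sum>i\<in>A. cnj (c i) * (\<Sum>j\<in>A. c j * (Ln (1 - cnj (v j) * v i) * K (v j) \<alpha> (v i))))"
  proof -
    have "(\<Sum>j\<in>A. c j * (s i j * exp (of_real \<alpha> * s i j)))
        = - (\<Sum>j\<in>A. c j * (Ln (1 - cnj (v j) * v i) * K (v j) \<alpha> (v i)))" if "i \<in> A" for i
      by (simp only: sum_negf[symmetric], intro sum.cong refl) (simp add: K[OF that], simp add: s_def)
    then have "(\<Sum>i\<in>A. cnj (c i) * (\<Sum>j\<in>A. c j * (s i j * exp (of_real \<alpha> * s i j))))
        = - (\<Sum>i\<in>A. cnj (c i) * (\<Sum>j\<in>A. c j * (Ln (1 - cnj (v j) * v i) * K (v j) \<alpha> (v i))))"
      by (simp only: sum_negf[symmetric] mult_minus_right[symmetric] cong: sum.cong)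
    then show ?thesis by (simp only: uminus_complex.sel)
  qed
  show "(I has_real_derivative
      2 * Re (\<Sum>i\<in>A. cnj (c i) * (h (v i) * exp (of_real \<alpha> * h (v i))))
      + Re (\<Sum>i\<in>A. cnj (c i) * (\<Sum>j\<in>A. c j * (Ln (1 - cnj (v j) * v i) * K (v j) \<alpha> (v i))))) (at \<alpha>)"
    using D unfolding 1[unfolded right_minus_eq] 2 .
qed

section \<open>From the weighted integral to the normalized norm\<close>

lemma O_star_log_bounded:
  assumes f: "f \<in> O_star" and h: "\<And>z. z \<in> ball 0 1 \<Longrightarrow> f z = exp (h z)"
  shows "\<exists>C. \<forall>z\<in>ball 0 1. \<bar>Re (h z)\<bar> \<le> C"
proof -
  obtain U where "cball 0 1 \<subseteq> U" "f holomorphic_on U" and nz: "\<And>z. z \<in> cball 0 1 \<Longrightarrow> f z \<noteq> 0"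
    using f by (auto simp: O_star_def)
  then have "continuous_on (cball 0 1) f"
    by (meson continuous_on_subset holomorphic_on_imp_continuous_on)
  then have "continuous_on (cball 0 1) (\<lambda>z. ln (norm (f z)))"
    by (intro continuous_intros) (use nz in auto)
  then have "bounded ((\<lambda>z. ln (norm (f z))) ` cball 0 1)"
    by (intro compact_imp_bounded compact_continuous_image) auto
  then obtain C where "\<forall>y\<in>(\<lambda>z. ln (norm (f z))) ` cball 0 1. norm y \<le> C"
    unfolding bounded_iff by blast
  then have "\<bar>ln (norm (f z))\<bar> \<le> C" if "z \<in> cball 0 1" for z
    using that by auto
  moreover have "ln (norm (f z)) = Re (h z)" if "z \<in> ball 0 1" for z
    using h[OF that] by simp
  ultimately show ?thesis by (metis ball_subset_cball subsetD)
qed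

lemma N_eq_bergman_integral:
  assumes h: "h holomorphic_on ball 0 1" and f: "\<And>z. z \<in> ball 0 1 \<Longrightarrow> f z = exp (h z)" and \<beta>: "\<beta> > 1"
  shows "N f \<beta> = (\<integral>z. exp (2 * \<beta> * Re (h z)) \<partial>bergman_measure \<beta>) powr (1 / (2 * \<beta>))"
proof -
  have cont: "continuous_on (ball 0 1) (\<lambda>z. exp (2 * \<beta> * Re (h z)))"
    by (intro continuous_intros holomorphic_on_imp_continuous_on[OF h])
  have "norm (f z) powr (2 * \<beta>) = exp (2 * \<beta> * Re (h z))" if "z \<in> ball 0 1" for z
    using f[OF that] by (simp add: powr_def)
  then have "(LINT z:ball 0 1|lborel. norm (f z) powr (2 * \<beta>) * (\<beta> - 1) * (1 - (norm z)\<^sup>2) powr (\<beta> - 2) / pi)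
      = (\<integral>z. exp (2 * \<beta> * Re (h z)) \<partial>bergman_measure \<beta>)"
    unfolding bergman_integral_eq_lborel[OF \<beta> cont] set_lebesgue_integral_def
    by (intro Bochner_Integration.integral_cong refl) (simp add: mult_ac split: split_indicator)
  then show ?thesis by (simp add: N_def)
qed

text \<open>
  Instance of the lower bound for the single node \<open>0\<close>, whose kernel is constant: the integral is at least
  \<open>|g 0|\<^sup>2\<close> for \<open>g = exp (\<beta> h)\<close>.
\<close>

lemma bergman_norm_pos:
  assumes h: "h holomorphic_on ball 0 1" and C: "\<And>z. z \<in> ball 0 1 \<Longrightarrow> \<bar>Re (h z)\<bar> \<le> C" and \<beta>: "\<beta> > 1"
  shows "0 < (\<integral>z. exp (2 * \<beta> * Re (h z)) \<partial>bergman_measure \<beta>)"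
proof -
  define g where "g = exp (of_real \<beta> * h 0)"
  have "2 * Re (cnj g * g) - Re (cnj g * g) \<le> (\<integral>z. exp (2 * \<beta> * Re (h z)) \<partial>bergman_measure \<beta>)"
    using bergman_norm_lower_bound(1)[OF h C \<beta>, of "{()}" "\<lambda>_. 0" "\<lambda>_. g"] by (simp add: K_def g_def)
  moreover have "Re (cnj g * g) > 0"
    by (simp add: g_def mult.commute[of "cnj _"] complex_norm_square[symmetric] del: of_real_power)
  ultimately show ?thesis by linarith
qed

lemma N_derivative_nonpos:
  assumes h: "h holomorphic_on ball 0 1" and f: "\<And>z. z \<in> ball 0 1 \<Longrightarrow> f z = exp (h z)"
    and C: "\<And>z. z \<in> ball 0 1 \<Longrightarrow> \<bar>Re (h z)\<bar> \<le> C" and \<alpha>: "\<alpha> > 1"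
  defines "I \<equiv> \<lambda>\<beta>. \<integral>z. exp (2 * \<beta> * Re (h z)) \<partial>bergman_measure \<beta>"
  assumes I': "(I has_real_derivative I') (at \<alpha>)" and le: "\<alpha> * I' \<le> I \<alpha> * ln (I \<alpha>)"
  shows "\<exists>D. (N f has_real_derivative D) (at \<alpha>) \<and> D \<le> 0"
proof -
  have pos: "I \<beta> > 0" if "\<beta> > 1" for \<beta>
    unfolding I_def by (rule bergman_norm_pos[OF h C that])
  define D where "D = exp (ln (I \<alpha>) / (2 * \<alpha>)) * ((\<alpha> * I' - I \<alpha> * ln (I \<alpha>)) / (2 * \<alpha>\<^sup>2 * I \<alpha>))"
  have "((\<lambda>\<beta>. exp (ln (I \<beta>) / (2 * \<beta>))) has_real_derivative D) (at \<alpha>)"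
    using pos[OF \<alpha>] \<alpha>
    by (auto intro!: derivative_eq_intros I' simp: D_def field_simps power2_eq_square)
  then have "(N f has_real_derivative D) (at \<alpha>)"
  proof (rule has_field_derivative_transform_within_open[where S = "{1<..}"])
    show "exp (ln (I \<beta>) / (2 * \<beta>)) = N f \<beta>" if "\<beta> \<in> {1<..}" for \<beta>
    proof -
      have "N f \<beta> = I \<beta> powr (1 / (2 * \<beta>))"
        unfolding I_def by (rule N_eq_bergman_integral[OF h f]) (use that in auto)
      then show ?thesis using pos[of \<beta>] that by (simp add: powr_def)
    qed
  qed (use \<alpha> in auto)
  moreover have "D \<le> 0"
    unfolding D_def using le pos[OF \<alpha>] \<alpha>
    by (intro mult_nonneg_nonpos divide_nonpos_nonneg) auto
  ultimately show ?thesis by blast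
qed

section \<open>The branch of the logarithm at the nodes\<close>

text \<open>
  The difference of the two logarithms of \<open>exp (H x)\<close> is continuous with values in \<open>2 \<pi> i \<int>\<close>.
\<close>

lemma log_branch_constant:
  fixes H :: "real \<Rightarrow> complex"
  assumes H: "continuous_on S H" and S: "connected S"
    and pos: "\<And>x. x \<in> S \<Longrightarrow> 0 < Re (exp (H x))" and ab: "a \<in> S" "b \<in> S"
  shows "H a - Ln (exp (H a)) = H b - Ln (exp (H b))"
proof -
  let ?\<phi> = "\<lambda>x. H x - Ln (exp (H x))"
  have "?\<phi> constant_on S"
  proof (rule continuous_discrete_range_constant[OF S])
    show "continuous_on S ?\<phi>"
      by (intro continuous_intros H) (use pos in \<open>force simp: complex_nonpos_Reals_iff\<close>)
    show "\<exists>e>0. \<forall>y. y \<in> S \<and> ?\<phi> y \<noteq> ?\<phi> x \<longrightarrow> e \<le> norm (?\<phi> y - ?\<phi> x)" if "x \<in> S" for x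
    proof (intro exI[of _ "2 * pi"] conjI allI impI)
      fix y assume y: "y \<in> S \<and> ?\<phi> y \<noteq> ?\<phi> x"
      define d where "d = ?\<phi> y - ?\<phi> x"
      have "exp (?\<phi> z) = 1" for z by (simp add: exp_diff)
      then have "exp d = 1" unfolding d_def exp_diff[of "?\<phi> y"] by simp
      then obtain n :: int where n: "Re d = 0" "Im d = of_int (2 * n) * pi"
        unfolding exp_eq_1 by blast
      have "d \<noteq> 0" using y by (simp add: d_def)
      then have "n \<noteq> 0" using n by (auto simp: complex_eq_iff)
      then have "\<bar>real_of_int n\<bar> \<ge> 1" by linarith
      then have "2 * pi * 1 \<le> 2 * pi * \<bar>real_of_int n\<bar>" by (intro mult_left_mono) auto
      also have "\<dots> = \<bar>Im d\<bar>" by (simp add: n abs_mult)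
      also have "\<dots> \<le> norm d" by (rule abs_Im_le_cmod)
      finally show "2 * pi \<le> norm (?\<phi> y - ?\<phi> x)" by (simp add: d_def)
    qed simp
  qed
  then show ?thesis using ab unfolding constant_on_def by metis
qed

text \<open>
  Quotients of two kernels are monotone on the real diameter, in a direction that depends only on
  the order of the two nodes.
\<close>

lemma kernel_quotient_mono:
  fixes a v x y \<alpha> :: real
  assumes "\<bar>a\<bar> < 1" "\<bar>v\<bar> < 1" "\<bar>x\<bar> < 1" "\<bar>y\<bar> < 1" and le: "0 \<le> (v - a) * (y - x)" and "\<alpha> \<ge> 0"
  shows "((1 - a * x) / (1 - v * x)) powr \<alpha> \<le> ((1 - a * y) / (1 - v * y)) powr \<alpha>"
proof -
  have pos: "0 < 1 - p * q" if "\<bar>p\<bar> < 1" "\<bar>q\<bar> < 1" for p q :: real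
    using abs_mult_less[OF that] by (simp add: abs_mult[symmetric])
  note p = pos[OF assms(1,3)] pos[OF assms(2,3)] pos[OF assms(1,4)] pos[OF assms(2,4)]
  have "(1 - a * x) * (1 - v * y) \<le> (1 - a * y) * (1 - v * x)"
    using le by (simp add: algebra_simps)
  then have "(1 - a * x) / (1 - v * x) \<le> (1 - a * y) / (1 - v * y)"
    using p by (simp add: field_simps)
  then show ?thesis using p \<open>\<alpha> \<ge> 0\<close> by (intro powr_mono2) auto
qed

text \<open>
  After division by the positive kernel of the node \<open>w s\<close>, the sum equals \<open>c s + \<sigma> G(x)\<close> with a real
  function \<open>G\<close> that is monotone along the segment from \<open>w s\<close> to \<open>w i\<close>.  So its values lie on a line
  segment whose endpoints are in the right half-plane.
\<close>

lemma one_sided_kernel_sum_Re_pos: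
  fixes w r :: "'i \<Rightarrow> real" and c :: "'i \<Rightarrow> complex" and \<sigma> :: complex and \<alpha> :: real
  assumes A: "finite A" "s \<in> A" and w: "\<And>i. i \<in> A \<Longrightarrow> \<bar>w i\<bar> < 1"
    and side: "\<And>i j. i \<in> A \<Longrightarrow> j \<in> A \<Longrightarrow> 0 \<le> (w i - w s) * (w j - w s)"
    and r: "\<And>i. i \<in> A \<Longrightarrow> 0 \<le> r i"
    and c: "\<And>i. i \<in> A - {s} \<Longrightarrow> c i = \<sigma> * of_real (r i)"
    and \<alpha>: "\<alpha> \<ge> 0"
  defines "u \<equiv> \<lambda>x. \<Sum>j\<in>A. c j * of_real ((1 - x * w j) powr (- \<alpha>))"
  assumes u: "0 < Re (u (w s))" "0 < Re (u (w i))" and i: "i \<in> A" and x: "x \<in> closed_segment (w s) (w i)"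
  shows "0 < Re (u x)"
proof -
  define \<rho> where "\<rho> j y = ((1 - w s * y) / (1 - w j * y)) powr \<alpha>" for j y
  define G where "G y = (\<Sum>j\<in>A-{s}. r j * \<rho> j y)" for y
  have pos: "0 < 1 - p * q" if "\<bar>p\<bar> < 1" "\<bar>q\<bar> < 1" for p q :: real
    using abs_mult_less[OF that] by (simp add: abs_mult[symmetric])
  have sum: "sum g A = g s + sum g (A - {s})" for g :: "'i \<Rightarrow> complex"
    by (rule sum.remove[OF A])
  have u_eq: "u y = of_real ((1 - y * w s) powr (- \<alpha>)) * (c s + \<sigma> * of_real (G y))" if y: "\<bar>y\<bar> < 1" for y
  proof -
    have "(1 - y * w j) powr (- \<alpha>) = (1 - y * w s) powr (- \<alpha>) * \<rho> j y" if "j \<in> A" for j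
      using pos[OF y w[OF that]] pos[OF y w[OF A(2)]]
      by (simp add: \<rho>_def powr_divide powr_minus_divide mult.commute)
    then have "u y = c s * of_real ((1 - y * w s) powr (- \<alpha>))
        + (\<Sum>j\<in>A-{s}. \<sigma> * of_real (r j) * (of_real ((1 - y * w s) powr (- \<alpha>)) * of_real (\<rho> j y)))"
      unfolding u_def sum by (simp add: c)
    then show ?thesis by (simp add: G_def sum_distrib_left algebra_simps)
  qed
  have Re_iff: "0 < Re (u y) \<longleftrightarrow> 0 < Re (c s) + Re \<sigma> * G y" if "\<bar>y\<bar> < 1" for y
    using pos[OF that w[OF A(2)]] by (simp add: u_eq[OF that] zero_less_mult_iff)
  obtain t where t: "0 \<le> t" "t \<le> 1" "x = (1 - t) * w s + t * w i"
    using x by (auto simp: closed_segment_def)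
  have x1: "\<bar>x\<bar> < 1"
  proof -
    have "\<bar>x\<bar> \<le> max \<bar>w s\<bar> \<bar>w i\<bar>"
      using x by (auto simp: closed_segment_eq_real_ivl abs_if max_def split: if_splits)
    then show ?thesis using w[OF A(2)] w[OF i] by linarith
  qed
  have mono: "G y \<le> G z" if "\<bar>y\<bar> < 1" "\<bar>z\<bar> < 1" "\<And>j. j \<in> A \<Longrightarrow> 0 \<le> (w j - w s) * (z - y)" for y z
    unfolding G_def \<rho>_def
    by (intro sum_mono mult_left_mono kernel_quotient_mono r) (use that w A(2) \<alpha> in auto)
  have G1: "G (w s) \<le> G x"
  proof (rule mono)
    show "0 \<le> (w j - w s) * (x - w s)" if "j \<in> A" for j
    proof -
      have "(w j - w s) * (x - w s) = t * ((w j - w s) * (w i - w s))" by (simp add: t(3) algebra_simps)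
      then show ?thesis using side[OF that i] t(1) by (metis mult_nonneg_nonneg)
    qed
  qed (use w A x1 in auto)
  have G2: "G x \<le> G (w i)"
  proof (rule mono)
    show "0 \<le> (w j - w s) * (w i - x)" if "j \<in> A" for j
    proof -
      have "(w j - w s) * (w i - x) = (1 - t) * ((w j - w s) * (w i - w s))" by (simp add: t(3) algebra_simps)
      then show ?thesis using side[OF that i] t(2) by (metis mult_nonneg_nonneg diff_ge_0_iff_ge)
    qed
  qed (use w i x1 in auto)
  show ?thesis
  proof (cases "Re \<sigma> \<ge> 0")
    case True
    then have "Re \<sigma> * G (w s) \<le> Re \<sigma> * G x" using G1 by (intro mult_left_mono)
    then show ?thesis using u(1) Re_iff[OF w[OF A(2)]] Re_iff[OF x1] by linarith
  next
    case False
    then have "Re \<sigma> * G (w i) \<le> Re \<sigma> * G x" using G2 by (intro mult_left_mono_neg) auto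
    then show ?thesis using u(2) Re_iff[OF w[OF i]] Re_iff[OF x1] by linarith
  qed
qed

section \<open>The monotonicity theorem\<close>

text \<open>
  The three alternatives have this feature in common.  For nonnegative coefficients the smallest node can be singled out; for ordered nodes the first or the last one;
  for two nodes either one, the other coefficient being its own phase times its absolute value.
\<close>

lemma distinguished_node:
  fixes c :: "complex list" and w :: "real list"
  assumes len: "length c = length w" "length w > 0"
    and "set c \<subseteq> \<real>\<^sub>\<ge>\<^sub>0
       \<or> sorted_wrt (<) w \<and>
           ((set (tl c) \<subseteq> \<real>\<^sub>\<ge>\<^sub>0 \<or> set (tl c) \<subseteq> \<real>\<^sub>\<le>\<^sub>0) \<or>
            (set (butlast c) \<subseteq> \<real>\<^sub>\<ge>\<^sub>0 \<or> set (butlast c) \<subseteq> \<real>\<^sub>\<le>\<^sub>0))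
       \<or> length w = 2"
  obtains s \<sigma> where "s < length w" "norm \<sigma> = 1"
    "\<And>i. i \<in> {..<length w} - {s} \<Longrightarrow> c ! i = \<sigma> * of_real (norm (c ! i))"
    "\<And>i j. i < length w \<Longrightarrow> j < length w \<Longrightarrow> 0 \<le> (w ! i - w ! s) * (w ! j - w ! s)"
proof -
  have nonneg: "z = 1 * of_real (norm z)" if "z \<in> \<real>\<^sub>\<ge>\<^sub>0" for z :: complex
    using that by (auto elim!: nonneg_Reals_cases)
  have nonpos: "z = - 1 * of_real (norm z)" if "z \<in> \<real>\<^sub>\<le>\<^sub>0" for z :: complex
    using that by (auto elim!: nonpos_Reals_cases)
  have signs: "\<exists>\<sigma>. norm \<sigma> = 1 \<and> (\<forall>z\<in>Z. z = \<sigma> * of_real (norm z))"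
    if "Z \<subseteq> \<real>\<^sub>\<ge>\<^sub>0 \<or> Z \<subseteq> \<real>\<^sub>\<le>\<^sub>0" for Z :: "complex set"
    using that
  proof
    assume "Z \<subseteq> \<real>\<^sub>\<ge>\<^sub>0"
    then show ?thesis using nonneg by (intro exI[of _ 1]) auto
  next
    assume "Z \<subseteq> \<real>\<^sub>\<le>\<^sub>0"
    then show ?thesis using nonpos by (intro exI[of _ "-1"]) auto
  qed
  from assms(3) consider (all) "set c \<subseteq> \<real>\<^sub>\<ge>\<^sub>0"
    | (tl) "sorted_wrt (<) w" "set (tl c) \<subseteq> \<real>\<^sub>\<ge>\<^sub>0 \<or> set (tl c) \<subseteq> \<real>\<^sub>\<le>\<^sub>0"
    | (butlast) "sorted_wrt (<) w" "set (butlast c) \<subseteq> \<real>\<^sub>\<ge>\<^sub>0 \<or> set (butlast c) \<subseteq> \<real>\<^sub>\<le>\<^sub>0"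
    | (two) "length w = 2"
    by blast
  then show ?thesis
  proof cases
    case all
    have "Min (set w) \<in> set w" using len by (intro Min_in) auto
    then obtain s where s: "s < length w" "w ! s = Min (set w)" by (metis in_set_conv_nth)
    have "w ! s \<le> w ! i" if "i < length w" for i unfolding s(2) using that by simp
    moreover have "c ! i = 1 * of_real (norm (c ! i))" if "i \<in> {..<length w} - {s}" for i
      using all len that by (intro nonneg) auto
    ultimately show ?thesis
      using s by (intro that[of s 1]) (auto intro!: mult_nonneg_nonneg)
  next
    case tl
    obtain \<sigma> where \<sigma>: "norm \<sigma> = 1" "\<And>z. z \<in> set (tl c) \<Longrightarrow> z = \<sigma> * of_real (norm z)"
      using signs[OF tl(2)] by blast
    have "c ! i \<in> set (tl c)" if "i \<in> {..<length w} - {0}" for i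
      using that len by (auto simp: in_set_conv_nth nth_tl intro!: exI[of _ "i - 1"])
    moreover have "w ! 0 \<le> w ! i" if "i < length w" for i
      using tl(1) that by (cases "i = 0") (auto simp: sorted_wrt_iff_nth_less less_imp_le)
    ultimately show ?thesis
      using \<sigma> len by (intro that[of 0 \<sigma>]) (auto intro!: mult_nonneg_nonneg)
  next
    case butlast
    obtain \<sigma> where \<sigma>: "norm \<sigma> = 1" "\<And>z. z \<in> set (butlast c) \<Longrightarrow> z = \<sigma> * of_real (norm z)"
      using signs[OF butlast(2)] by blast
    have "c ! i \<in> set (butlast c)" if "i \<in> {..<length w} - {length w - 1}" for i
      using that len by (auto simp: in_set_conv_nth nth_butlast intro!: exI[of _ i])
    moreover have "w ! i \<le> w ! (length w - 1)" if "i < length w" for i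
      using butlast(1) that by (cases "i = length w - 1") (auto simp: sorted_wrt_iff_nth_less less_imp_le)
    ultimately show ?thesis
      using \<sigma> len by (intro that[of "length w - 1" \<sigma>]) (auto intro!: mult_nonpos_nonpos)
  next
    case two
    define \<sigma> where "\<sigma> = (if c ! 1 = 0 then 1 else sgn (c ! 1))"
    have "norm \<sigma> = 1" by (simp add: \<sigma>_def norm_sgn)
    moreover have "c ! i = \<sigma> * of_real (norm (c ! i))" if "i \<in> {..<length w} - {0}" for i
    proof -
      have "i = 1" using that two by auto
      then show ?thesis by (auto simp: \<sigma>_def sgn_eq)
    qed
    moreover have "0 \<le> (w ! i - w ! 0) * (w ! j - w ! 0)" if "i < length w" "j < length w" for i j
      using that two by (auto simp: less_2_cases_iff)
    ultimately show ?thesis using two by (intro that[of 0 \<sigma>]) auto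
  qed
qed

theorem theorem3p9:
  fixes f h :: "complex \<Rightarrow> complex" and \<alpha> :: real
    and c :: "complex list" and w :: "real list"
  assumes "f \<in> O_star"
    and "\<alpha> > 1"
    and "h holomorphic_on ball 0 1"
    and "\<forall>z\<in>ball 0 1. f z = exp (h z)"
    and "\<forall>z\<in>ball 0 1. exp (of_real \<alpha> * h z) =
           (\<Sum>i<length w. c ! i * K (of_real (w ! i)) \<alpha> z)"
    and "(c, w) \<in> Lambda_set \<alpha> \<union> Gamma_set"
    and "set c \<subseteq> \<real>\<^sub>\<ge>\<^sub>0
       \<or> sorted_wrt (<) w \<and>
           ((set (tl c) \<subseteq> \<real>\<^sub>\<ge>\<^sub>0 \<or> set (tl c) \<subseteq> \<real>\<^sub>\<le>\<^sub>0) \<or>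
            (set (butlast c) \<subseteq> \<real>\<^sub>\<ge>\<^sub>0 \<or> set (butlast c) \<subseteq> \<real>\<^sub>\<le>\<^sub>0))
       \<or> length w = 2"
  shows "\<exists>D. (N f has_real_derivative D) (at \<alpha>) \<and> D \<le> 0"
proof -
  define A where "A = {..<length w}"
  define v where "v i = complex_of_real (w ! i)" for i
  define k where "k x y = (1 - x * y) powr (- \<alpha>)" for x y :: real
  define u where "u x = (\<Sum>j\<in>A. c ! j * of_real (k x (w ! j)))" for x
  define H where "H x = of_real \<alpha> * h (complex_of_real x)" for x
  define E where "E = Re (\<Sum>i\<in>A. cnj (c ! i) * u (w ! i))"
  have len: "length c = length w" "length w > 0" and wset: "set w \<subseteq> {-1<..<1}"
    using assms(6) by (auto simp: Lambda_set_def Gamma_set_def)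
  have w: "\<bar>w ! i\<bar> < 1" if "i \<in> A" for i
  proof -
    have "w ! i \<in> {-1<..<1}" by (rule subsetD[OF wset]) (use that in \<open>simp add: A_def\<close>)
    then show ?thesis by (auto simp: abs_less_iff)
  qed
  have A: "finite A" by (simp add: A_def)
  have v: "v i \<in> ball 0 1" if "i \<in> A" for i using w[OF that] by (simp add: v_def)
  have pos: "0 < 1 - x * y" if "\<bar>x\<bar> < 1" "\<bar>y\<bar> < 1" for x y :: real
    using abs_mult_less[OF that] by (simp add: abs_mult[symmetric])
  have K: "K (v j) \<alpha> (of_real x) = of_real (k x (w ! j))" if "\<bar>x\<bar> < 1" "j \<in> A" for j x
  proof -
    have "K (v j) \<alpha> (of_real x) = 1 / of_real ((1 - x * w ! j)) powr of_real \<alpha>"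
      by (simp add: K_def v_def mult.commute)
    also have "\<dots> = of_real (k x (w ! j))"
      using pos[OF that(1) w[OF that(2)]] by (simp only: powr_of_real k_def powr_minus_divide less_imp_le) simp
    finally show ?thesis .
  qed
  have rep: "exp (of_real \<alpha> * h z) = (\<Sum>i\<in>A. c ! i * K (v i) \<alpha> z)" if "z \<in> ball 0 1" for z
    using assms(5) that by (simp add: A_def v_def)
  have H_exp: "exp (H x) = u x" if "\<bar>x\<bar> < 1" for x
    unfolding H_def u_def using rep[of "of_real x"] that by (simp add: K)
  have H_cont: "continuous_on {-1<..<1} H"
    unfolding H_def
    by (intro continuous_intros continuous_on_compose2[OF holomorphic_on_imp_continuous_on[OF assms(3)]])
      (auto simp: abs_less_iff)
  obtain C where C: "\<And>z. z \<in> ball 0 1 \<Longrightarrow> \<bar>Re (h z)\<bar> \<le> C"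
    using O_star_log_bounded[OF assms(1)] assms(4) by blast
  obtain s \<sigma> where s: "s \<in> A" and \<sigma>: "norm \<sigma> = 1"
    and c: "\<And>i. i \<in> A - {s} \<Longrightarrow> c ! i = \<sigma> * of_real (norm (c ! i))"
    and side: "\<And>i j. i \<in> A \<Longrightarrow> j \<in> A \<Longrightarrow> 0 \<le> (w ! i - w ! s) * (w ! j - w ! s)"
    using distinguished_node[OF len assms(7)] unfolding A_def by (metis lessThan_iff)
  \<comment> \<open>The entropy inequality with the logarithm \<open>H\<close> of \<open>u\<close> that comes from \<open>h\<close>.\<close>
  have ineq: "2 * Re (\<Sum>i\<in>A. cnj (c ! i) * (u (w ! i) * H (w ! i)))
     \<le> Re (\<Sum>i\<in>A. \<Sum>j\<in>A. cnj (c ! i) * c ! j * of_real (k (w ! i) (w ! j) * ln (k (w ! i) (w ! j)))) + E * ln E"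
    using assms(6)
  proof
    assume "(c, w) \<in> Lambda_set \<alpha>"
    then have "0 < Re (\<Sum>j\<in>A. c ! j * K (v j) \<alpha> (of_real (w ! i)))" if "i \<in> A" for i
      using that by (auto simp: Lambda_set_def right_half_plane_def A_def v_def)
    then have u_pos: "0 < Re (u (w ! i))" if "i \<in> A" for i
      using that by (simp add: K w u_def)
    define \<kappa> where "\<kappa> = H (w ! s) - Ln (u (w ! s))"
    have H_Ln: "H (w ! i) = Ln (u (w ! i)) + \<kappa>" if "i \<in> A" for i
    proof -
      let ?S = "closed_segment (w ! s) (w ! i)"
      have sub: "?S \<subseteq> {-1<..<1}"
        using w[OF s] w[OF that] by (auto simp: closed_segment_eq_real_ivl abs_less_iff split: if_splits)
      have "H (w ! s) - Ln (exp (H (w ! s))) = H (w ! i) - Ln (exp (H (w ! i)))"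
      proof (rule log_branch_constant)
        show "continuous_on ?S H" by (rule continuous_on_subset[OF H_cont sub])
        show "0 < Re (exp (H x))" if x: "x \<in> ?S" for x
        proof -
          have "\<bar>x\<bar> < 1" using sub x by (auto simp: abs_less_iff)
          moreover have "0 < Re (u x)"
            unfolding u_def k_def
            by (rule one_sided_kernel_sum_Re_pos[where s = s and i = i and \<sigma> = \<sigma> and w = "\<lambda>i. w ! i" and r = "\<lambda>i. norm (c ! i)"])
              (use A s w side c x assms(2) \<open>i \<in> A\<close> u_pos in \<open>auto simp: u_def k_def\<close>)
          ultimately show ?thesis by (simp add: H_exp)
        qed
      qed auto
      then show ?thesis by (simp add: \<kappa>_def H_exp w s that algebra_simps)
    qed
    have \<kappa>0: "Re \<kappa> = 0"
    proof -
      have "u (w ! s) \<noteq> 0" using u_pos[OF s] by auto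
      then have "exp \<kappa> = 1"
        by (simp add: \<kappa>_def exp_diff H_exp w s)
      then show ?thesis by (simp add: exp_eq_1)
    qed
    \<comment> \<open>The form is Hermitian, so the imaginary constant \<open>\<kappa>\<close> contributes nothing to the real part.\<close>
    have real: "Im (\<Sum>i\<in>A. cnj (c ! i) * u (w ! i)) = 0"
    proof -
      let ?Q = "\<Sum>i\<in>A. \<Sum>j\<in>A. cnj (c ! i) * c ! j * of_real (k (w ! i) (w ! j))"
      have "cnj ?Q = (\<Sum>i\<in>A. \<Sum>j\<in>A. cnj (c ! j) * c ! i * of_real (k (w ! j) (w ! i)))"
        by (simp add: k_def mult_ac)
      also have "\<dots> = ?Q" by (rule sum.swap)
      finally have "?Q \<in> \<real>" by (simp add: Reals_cnj_iff)
      then show ?thesis by (simp add: u_def sum_distrib_left complex_is_Real_iff mult.assoc)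
    qed
    have "(\<Sum>i\<in>A. cnj (c ! i) * (u (w ! i) * H (w ! i)))
        = (\<Sum>i\<in>A. cnj (c ! i) * (u (w ! i) * Ln (u (w ! i)))) + (\<Sum>i\<in>A. cnj (c ! i) * u (w ! i)) * \<kappa>"
      by (simp add: H_Ln distrib_left sum.distrib sum_distrib_left mult_ac)
    then have "Re (\<Sum>i\<in>A. cnj (c ! i) * (u (w ! i) * H (w ! i)))
        = Re (\<Sum>i\<in>A. cnj (c ! i) * (u (w ! i) * Ln (u (w ! i))))"
      using \<kappa>0 real by (simp only: plus_complex.sel times_complex.sel mult_zero_left mult_zero_right diff_zero add_0_right)
    then show ?thesis
      using kernel_entropy_inequality[of A s "\<lambda>i. w ! i" "\<lambda>i. norm (c ! i)" \<sigma> "\<lambda>i. c ! i" \<alpha>]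
        A s w side c \<sigma> assms(2) u_pos
      unfolding E_def u_def k_def by simp
  next
    assume "(c, w) \<in> Gamma_set"
    then have "set c \<subseteq> \<real>" by (simp add: Gamma_set_def)
    then have cR: "Im (c ! i) = 0" if "i \<in> A" for i
      unfolding complex_is_Real_iff[symmetric] by (rule subsetD) (use that len in \<open>simp add: A_def\<close>)
    have uR: "Im (u x) = 0" for x using cR by (simp add: u_def)
    have u_nz: "Re (u x) \<noteq> 0" if "\<bar>x\<bar> < 1" for x
      using H_exp[OF that] exp_not_eq_zero[of "H x"] uR[of x] by (auto simp: complex_eq_iff)
    have "continuous_on {-1<..<1} (\<lambda>x. Re (exp (H x)))" by (intro continuous_intros H_cont)
    then have conn: "connected ((\<lambda>x. Re (exp (H x))) ` {-1<..<1})"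
      by (rule connected_continuous_image) simp
    have "\<not> (Re (u x) < 0 \<and> 0 < Re (u y))" if xy: "\<bar>x\<bar> < 1" "\<bar>y\<bar> < 1" for x y
    proof
      assume uxy: "Re (u x) < 0 \<and> 0 < Re (u y)"
      have "Re (u z) \<in> (\<lambda>x. Re (exp (H x))) ` {-1<..<1}" if "\<bar>z\<bar> < 1" for z
        using that H_exp[OF that] by (intro image_eqI[of _ _ z]) (auto simp: abs_less_iff)
      from this[OF xy(1)] this[OF xy(2)] uxy have "0 \<in> (\<lambda>x. Re (exp (H x))) ` {-1<..<1}"
        using conn unfolding connected_iff_interval by (meson less_imp_le)
      then obtain z where "\<bar>z\<bar> < 1" "Re (exp (H z)) = 0" by (auto simp: abs_less_iff)
      then show False using u_nz H_exp by simp
    qed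
    then have "(\<forall>x. \<bar>x\<bar> < 1 \<longrightarrow> Re (u x) > 0) \<or> (\<forall>x. \<bar>x\<bar> < 1 \<longrightarrow> Re (u x) < 0)"
      using u_nz by (meson linorder_neqE_linordered_idom)
    \<comment> \<open>The sign \<open>\<epsilon>\<close> of \<open>u\<close> moves all values to the positive axis; changing the sign of all
      coefficients does not affect the inequality.\<close>
    then obtain \<epsilon> :: real where \<epsilon>: "\<epsilon> = 1 \<or> \<epsilon> = -1" "\<And>x. \<bar>x\<bar> < 1 \<Longrightarrow> 0 < \<epsilon> * Re (u x)"
      by (metis mult_1 mult_minus1 neg_0_less_iff_less)
    have \<epsilon>u: "of_real \<epsilon> * u x = (\<Sum>j\<in>A. of_real \<epsilon> * c ! j * of_real (k x (w ! j)))" for x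
      by (simp add: u_def sum_distrib_left mult.assoc)
    have "Re (cnj (c ! i) * (u (w ! i) * H (w ! i)))
        = Re (cnj (of_real \<epsilon> * c ! i) * (of_real \<epsilon> * u (w ! i) * Ln (of_real \<epsilon> * u (w ! i))))" if i: "i \<in> A" for i
    proof -
      define y where "y = Re (u (w ! i))"
      have uy: "u (w ! i) = of_real y" using uR by (simp add: y_def complex_eq_iff)
      have y: "0 < \<epsilon> * y" unfolding y_def by (rule \<epsilon>(2)[OF w[OF i]])
      have "exp (Re (H (w ! i))) = norm (u (w ! i))" unfolding H_exp[OF w[OF i], symmetric] by simp
      also have "\<dots> = \<epsilon> * y" using \<epsilon>(1) y by (auto simp: uy)
      finally have "Re (H (w ! i)) = ln (\<epsilon> * y)" by (metis ln_exp)
      moreover have "Ln (of_real \<epsilon> * u (w ! i)) = of_real (ln (\<epsilon> * y))"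
        using Ln_of_real[OF y] by (simp add: uy)
      ultimately show ?thesis
        using \<epsilon>(1) cR[OF i] by (auto simp: uy)
    qed
    then have 1: "Re (\<Sum>i\<in>A. cnj (c ! i) * (u (w ! i) * H (w ! i)))
        = Re (\<Sum>i\<in>A. cnj (of_real \<epsilon> * c ! i) * (of_real \<epsilon> * u (w ! i) * Ln (of_real \<epsilon> * u (w ! i))))"
      unfolding Re_sum by (intro sum.cong refl)
    have 2: "E = Re (\<Sum>i\<in>A. cnj (of_real \<epsilon> * c ! i) * (of_real \<epsilon> * u (w ! i)))"
      unfolding E_def using \<epsilon>(1) by auto
    have 3: "(\<Sum>i\<in>A. \<Sum>j\<in>A. cnj (c ! i) * c ! j * of_real (k (w ! i) (w ! j) * ln (k (w ! i) (w ! j))))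
        = (\<Sum>i\<in>A. \<Sum>j\<in>A. cnj (of_real \<epsilon> * c ! i) * (of_real \<epsilon> * c ! j) * of_real (k (w ! i) (w ! j) * ln (k (w ! i) (w ! j))))"
      using \<epsilon>(1) by auto
    show ?thesis
      unfolding 1 2 3 unfolding \<epsilon>u k_def
    proof (rule kernel_entropy_inequality[where s = s and \<sigma> = "of_real \<epsilon> * \<sigma>" and w = "\<lambda>i. w ! i" and r = "\<lambda>i. norm (c ! i)"
          and c = "\<lambda>i. of_real \<epsilon> * c ! i"])
      show "norm (of_real \<epsilon> * \<sigma>) = 1" using \<sigma> \<epsilon>(1) by (auto simp: norm_mult)
      show "of_real \<epsilon> * c ! i = of_real \<epsilon> * \<sigma> * of_real (norm (c ! i))" if "i \<in> A - {s}" for i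
        using c[OF that] by (metis mult.assoc)
      show "0 < Re (\<Sum>j\<in>A. of_real \<epsilon> * c ! j * of_real ((1 - w ! i * w ! j) powr - \<alpha>))" if "i \<in> A" for i
        unfolding k_def[symmetric] \<epsilon>u[symmetric] using \<epsilon>(2)[OF w[OF that]] by simp
    qed (use A s w side assms(2) in auto)
  qed
  let ?I = "\<lambda>\<beta>. \<integral>z. exp (2 * \<beta> * Re (h z)) \<partial>bergman_measure \<beta>"
  have uH: "exp (of_real \<alpha> * h (v i)) = u (w ! i)" if "i \<in> A" for i
    using H_exp[OF w[OF that]] by (simp add: H_def v_def)
  have I: "?I \<alpha> = E"
    using bergman_norm_derivative(1)[OF assms(3) C assms(2) A v rep] by (simp add: E_def uH)
  have I': "(?I has_real_derivative
      2 * Re (\<Sum>i\<in>A. cnj (c ! i) * (h (v i) * exp (of_real \<alpha> * h (v i))))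
      + Re (\<Sum>i\<in>A. cnj (c ! i) * (\<Sum>j\<in>A. c ! j * (Ln (1 - cnj (v j) * v i) * K (v j) \<alpha> (v i))))) (at \<alpha>)"
    by (rule bergman_norm_derivative(2)[OF assms(3) C assms(2) A v rep])
  show ?thesis
  proof (rule N_derivative_nonpos[OF assms(3) _ C assms(2) I'])
    show "f z = exp (h z)" if "z \<in> ball 0 1" for z using assms(4) that by blast
    have 1: "of_real \<alpha> * (\<Sum>i\<in>A. cnj (c ! i) * (h (v i) * exp (of_real \<alpha> * h (v i))))
        = (\<Sum>i\<in>A. cnj (c ! i) * (u (w ! i) * H (w ! i)))"
      unfolding sum_distrib_left by (intro sum.cong refl) (simp only: uH, simp add: H_def v_def mult_ac)
    have 2: "of_real \<alpha> * (\<Sum>i\<in>A. cnj (c ! i) * (\<Sum>j\<in>A. c ! j * (Ln (1 - cnj (v j) * v i) * K (v j) \<alpha> (v i))))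
        = - (\<Sum>i\<in>A. \<Sum>j\<in>A. cnj (c ! i) * c ! j * of_real (k (w ! i) (w ! j) * ln (k (w ! i) (w ! j))))"
    proof -
      have "of_real \<alpha> * (cnj (c ! i) * (c ! j * (Ln (1 - cnj (v j) * v i) * K (v j) \<alpha> (v i))))
        = - (cnj (c ! i) * c ! j * of_real (k (w ! i) (w ! j) * ln (k (w ! i) (w ! j))))" if "i \<in> A" "j \<in> A" for i j
      proof -
        have p: "0 < 1 - w ! i * w ! j" by (rule pos[OF w[OF that(1)] w[OF that(2)]])
        have "Ln (1 - cnj (v j) * v i) = of_real (ln (1 - w ! i * w ! j))"
          using Ln_of_real[OF p] by (simp add: v_def mult.commute)
        moreover have "K (v j) \<alpha> (v i) = of_real (k (w ! i) (w ! j))"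
          using K[OF w[OF that(1)] that(2)] by (simp add: v_def)
        moreover have "ln (k (w ! i) (w ! j)) = - \<alpha> * ln (1 - w ! i * w ! j)"
          using p by (simp add: k_def ln_powr)
        ultimately show ?thesis by simp
      qed
      then show ?thesis
        by (simp only: sum_distrib_left sum_negf[symmetric] cong: sum.cong)
    qed
    have "\<alpha> * (2 * Re X + Re Y) = 2 * Re (of_real \<alpha> * X) + Re (of_real \<alpha> * Y)" for X Y :: complex
      by (simp add: algebra_simps)
    then show "\<alpha> * (2 * Re (\<Sum>i\<in>A. cnj (c ! i) * (h (v i) * exp (of_real \<alpha> * h (v i))))
      + Re (\<Sum>i\<in>A. cnj (c ! i) * (\<Sum>j\<in>A. c ! j * (Ln (1 - cnj (v j) * v i) * K (v j) \<alpha> (v i)))))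
      \<le> ?I \<alpha> * ln (?I \<alpha>)"
      unfolding I 1 2 using ineq by (simp only: 1 2 uminus_complex.sel)
  qed
qed


end
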